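(* Let $M\ge0$ and $\delta>0$ be real numbers and let $C_{[-M,M],\delta}$ be the Beurling-Selberg majorant of the characteristic function of $[-M,M]$ defined in the context. Then $$\int_{-\infty}^{\infty}\bigl|C_{[-M,M],\delta}(t)\bigr|^2dt\le 2M+\mathfrak{c}\,\delta^{-1},$$ where $$\mathfrak{c}=\frac43+\frac{2}{\pi^2}\int_0^1\hat J(v)\hat J'(v)\frac{dv}{v}=0.898678\cdots.$$
   Context: The function $\hat J$ is given by $\hat J(0)=1$, $\hat J(t)=\pi t(1-|t|)\cot(\pi t)+|t|$ for $0<|t|<1$, and $\hat J(t)=0$ for $|t|\ge1$. Put $$K(z)=\Bigl(\frac{\sin\pi z}{\pi z}\Bigr)^2,\qquad H(z)=\Bigl(\frac{\sin\pi z}{\pi}\Bigr)^2\Bigl(\sum_{m\in\mathbb{Z}}\frac{\operatorname{sgn}(m)}{(z-m)^2}+\frac2z\Bigr)$$ (with $\operatorname{sgn}(0)=0$, and extended by continuity), $B(x)=K(x)+H(x)$, and for real $a\le b$ and $\delta>0$, $$C_{[a,b],\delta}(x)=\tfrac12\bigl(B(\delta(b-x))+B(\delta(x-a))\bigr).$$ *)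

theory Defs
  imports "HOL-Analysis.Analysis"
begin

definition J_hat :: "real \<Rightarrow> real" where
  "J_hat t =
     (if t = 0 then 1
      else if \<bar>t\<bar> < 1 then pi * t * (1 - \<bar>t\<bar>) * cot (pi * t) + \<bar>t\<bar>
      else 0)"

text \<open>
  The functions below are stated over any real normed field with the usual sine, so that
  they make sense both on the complex plane and on the real line.
\<close>

definition K_fun :: "'a :: {real_normed_field, banach} \<Rightarrow> 'a" where
  "K_fun z = (if z = 0 then 1 else (sin (of_real pi * z) / (of_real pi * z))\<^sup>2)"

definition H_formula :: "'a :: {real_normed_field, banach} \<Rightarrow> 'a" where
  "H_formula z =
     (sin (of_real pi * z) / of_real pi)\<^sup>2 *
     ((\<Sum>\<^sub>\<infinity>m\<in>(UNIV :: int set). of_int (sgn m) / (z - of_int m)\<^sup>2) + 2 / z)"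

text \<open>At the integers the formula has removable singularities, where \<open>H_fun\<close> takes the limit.\<close>

definition H_fun :: "'a :: {real_normed_field, banach} \<Rightarrow> 'a" where
  "H_fun z = (if z \<in> \<int> then Lim (at z) H_formula else H_formula z)"

definition B_fun :: "real \<Rightarrow> real" where
  "B_fun x = K_fun x + H_fun x"

definition C_majorant :: "real \<Rightarrow> real \<Rightarrow> real \<Rightarrow> real \<Rightarrow> real" where
  "C_majorant a b \<delta> x = (B_fun (\<delta> * (b - x)) + B_fun (\<delta> * (x - a))) / 2"

definition J_integrand :: "real \<Rightarrow> real" where
  "J_integrand v = J_hat v * deriv J_hat v / v"

text \<open>
  The integral is taken over the open interval: \<open>J_hat\<close> has a derivative there, and the
  endpoints form a null set.
\<close>

definition c_const :: real where
  "c_const = 4 / 3 + 2 / pi\<^sup>2 * (LBINT v:{0<..<1}. J_integrand v)"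

end

theory Submission
  imports Defs "HOL-Probability.Sinc_Integral" "HOL-Real_Asymp.Real_Asymp"
begin

text \<open>
  Rescaling reduces everything to \<open>\<delta> = 1\<close>. Put \<open>E = B - sgn\<close>, a nonnegative integrable function.
  Expanding the square with \<open>L = 2 M\<close> gives
  \<open>\<integral> C\<^sup>2 = L + 2 \<integral>\<^sub>0\<^sup>L E + (\<integral> E\<^sup>2) / 2 + (\<integral> E(u) E(L - u) du) / 2\<close>, so the bound is equivalent to
  \<open>\<integral> E(u) E(L - u) du \<le> 4 \<integral>\<^sub>L\<^sup>\<infinity> E\<close> once one knows
  \<open>c = 2 \<integral>\<^sub>0\<^sup>\<infinity> E + (\<integral> E\<^sup>2) / 2\<close>.

  Since \<open>E \<le> 2\<close> on the negative axis and \<open>E \<le> 1/7\<close> left of \<open>-1\<close>, the range where \<open>u\<close> or \<open>L - u\<close> is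
  negative uses up less than the allowed amount, by \<open>26/7 \<integral>\<^bsub>L+1\<^esub>\<^sup>\<infinity> E\<close>; this is enough room
  for the range \<open>0 < u < L\<close>.

  Both expressions for \<open>c\<close> equal \<open>1 - 1/\<pi>\<^sup>2\<close>. The integral over \<open>(0,1)\<close> has an elementary
  antiderivative. The other one reduces to \<open>\<integral> (1 - H\<^sup>2)\<close>, which needs no Fourier analysis: for
  \<open>f = 1 - H\<^sup>2\<close> one has \<open>\<integral> f = \<integral> (y + 1/2) (f(y) - f(y + 1)) dy\<close>, and
  \<open>H(y + 1) - H(y) = sin\<^sup>2(\<pi>y) / (\<pi>\<^sup>2 y\<^sup>2 (y + 1)\<^sup>2)\<close> turns the right-hand side into an explicit integral of
  \<open>sin\<^sup>4(\<pi>y)\<close> times a rational function.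
\<close>

subsection \<open>Integrals of powers of the sine\<close>

lemma lborel_has_bochner_integral_reflect:
  fixes f :: "real \<Rightarrow> real"
  assumes "has_bochner_integral lborel f I"
  shows "has_bochner_integral lborel (\<lambda>x. f (c - x)) I"
  using lborel_has_bochner_integral_real_affine_iff[of "-1" f I c] assms by simp

lemma lborel_has_bochner_integral_shift:
  fixes f :: "real \<Rightarrow> real"
  assumes "has_bochner_integral lborel f I"
  shows "has_bochner_integral lborel (\<lambda>x. f (x + c)) I"
  using lborel_has_bochner_integral_real_affine_iff[of 1 f I c] assms by (simp add: add.commute)

lemma lborel_integral_reflect:
  fixes f :: "real \<Rightarrow> real"
  shows "(\<integral>x. f (c - x) \<partial>lborel) = (\<integral>x. f x \<partial>lborel)"
  using lborel_integral_real_affine[of "-1" f c] by simp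

lemma lborel_integral_shift:
  fixes f :: "real \<Rightarrow> real"
  shows "(\<integral>x. f (x + c) \<partial>lborel) = (\<integral>x. f x \<partial>lborel)"
  using lborel_integral_real_affine[of 1 f c] by (simp add: add.commute)

lemma lborel_integrable_reflect:
  fixes f :: "real \<Rightarrow> real"
  shows "integrable lborel f \<Longrightarrow> integrable lborel (\<lambda>x. f (c - x))"
  using lborel_integrable_real_affine[of f "-1" c] by simp

lemma lborel_integrable_shift:
  fixes f :: "real \<Rightarrow> real"
  shows "integrable lborel f \<Longrightarrow> integrable lborel (\<lambda>x. f (x + c))"
  using lborel_integrable_real_affine[of f 1 c] by (simp add: add.commute)

lemma lborel_integral_fold:
  fixes f :: "real \<Rightarrow> real"
  assumes "integrable lborel f"
  shows "(\<integral>x. f x \<partial>lborel) = (\<integral>x. indicator {0<..} x * (f x + f (- x)) \<partial>lborel)"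
proof -
  have i: "integrable lborel (\<lambda>x. indicator {0<..} x * f x)" "integrable lborel (\<lambda>x. indicator {..<0} x * f x)"
    using integrable_real_mult_indicator[OF _ assms, of "{0<..}"] integrable_real_mult_indicator[OF _ assms, of "{..<0}"]
    by (simp_all add: mult.commute)
  have "(\<integral>x. f x \<partial>lborel) = (\<integral>x. indicator {0<..} x * f x + indicator {..<0} x * f x \<partial>lborel)"
    using assms i by (intro integral_discrete_difference[where X="{0}"]) (auto split: split_indicator)
  also have "\<dots> = (\<integral>x. indicator {0<..} x * f x \<partial>lborel) + (\<integral>x. indicator {..<0} x * f x \<partial>lborel)"
    using i by simp
  also have "(\<integral>x. indicator {..<0} x * f x \<partial>lborel) = (\<integral>x. indicator {..<0} (0 - x) * f (0 - x) \<partial>lborel)"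
    by (rule lborel_integral_reflect[symmetric])
  also have "\<dots> = (\<integral>x. indicator {0<..} x * f (-x) \<partial>lborel)"
    by (intro Bochner_Integration.integral_cong) (auto split: split_indicator)
  also have "integrable lborel (\<lambda>x. indicator {0<..} x * f (-x))"
    using integrable_real_mult_indicator[OF _ lborel_integrable_reflect[OF assms, of 0], of "{0<..}"]
    by (simp add: mult.commute)
  with i have "(\<integral>x. indicator {0<..} x * f x \<partial>lborel) + (\<integral>x. indicator {0<..} x * f (-x) \<partial>lborel)
     = (\<integral>x. indicator {0<..} x * (f x + f (- x)) \<partial>lborel)"
    by (simp add: distrib_left)
  finally show ?thesis .
qed

text \<open>Nonnegativity lets the fundamental theorem on the open half-line deliver integrability
  together with the value, and evenness doubles it. No regularity at 0 is assumed: measurability of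
  \<open>f\<close> is recovered from \<open>g\<close>, which agrees with it off that one
  point.\<close>

lemma has_bochner_integral_even_FTC:
  fixes f F :: "real \<Rightarrow> real"
  assumes deriv: "\<And>x. 0 < x \<Longrightarrow> (F has_real_derivative f x) (at x)"
    and cont: "\<And>x. 0 < x \<Longrightarrow> isCont f x"
    and nonneg: "\<And>x. 0 < x \<Longrightarrow> 0 \<le> f x"
    and even: "\<And>x. f (- x) = f x"
    and lim0: "(F \<longlongrightarrow> 0) (at_right 0)"
    and lim: "(F \<longlongrightarrow> l) at_top"
  shows "has_bochner_integral lborel f (2 * l)"
proof -
  have A: "((F \<circ> real_of_ereal) \<longlongrightarrow> 0) (at_right 0)" "((F \<circ> real_of_ereal) \<longlongrightarrow> l) (at_left \<infinity>)"
    using lim0 lim by (simp_all add: zero_ereal_def ereal_tendsto_simps)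
  have pos: "\<And>x. 0 < ereal x \<Longrightarrow> 0 < x" by (simp add: zero_ereal_def)
  have B1: "set_integrable lborel (einterval 0 \<infinity>) f"
    by (rule interval_integral_FTC_nonneg(1)[where F=F, OF _ _ _ _ A]) (use assms pos in \<open>auto\<close>)
  have B2: "(LBINT x=0..\<infinity>. f x) = l - 0"
    by (rule interval_integral_FTC_nonneg(2)[where F=F, OF _ _ _ _ A]) (use assms pos in \<open>auto\<close>)
  have C: "has_bochner_integral lborel (\<lambda>x. indicator {0<..} x * f x) l"
    using B1 B2 unfolding interval_lebesgue_integral_0_infty by (simp add: has_bochner_integral_iff set_integrable_def
      set_lebesgue_integral_def zero_ereal_def)
  define g where "g x = indicator {0<..} x * f x + indicator {0<..} (0 - x) * f (0 - x)" for x
  have g: "has_bochner_integral lborel g (l + l)"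
    unfolding g_def by (intro has_bochner_integral_add C lborel_has_bochner_integral_reflect[OF C])
  have "(\<lambda>x. if x \<in> {0} then f x else g x) \<in> borel_measurable lborel"
    by (rule measurable_discrete_difference[where X="{0}", OF borel_measurable_has_bochner_integral[OF g]]) auto
  moreover have eq: "g x = f x" if "x \<noteq> 0" for x
    using even[of x] that by (auto simp: g_def split: split_indicator)
  then have "(\<lambda>x. if x \<in> {0} then f x else g x) = f" by auto
  ultimately have f: "f \<in> borel_measurable lborel" by simp
  have "AE x in lborel. g x = f x"
    using AE_lborel_singleton[of 0] by eventually_elim (rule eq)
  then show ?thesis
    using has_bochner_integral_cong_AE[OF borel_measurable_has_bochner_integral[OF g] f] g by simp
qed

lemma Si_scale_lim:
  assumes "c > 0"
  shows "((\<lambda>x. Si (c * x)) \<longlongrightarrow> pi / 2) at_top" "((\<lambda>x. Si (c * x)) \<longlongrightarrow> 0) (at_right 0)"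
proof -
  show "((\<lambda>x. Si (c * x)) \<longlongrightarrow> pi / 2) at_top"
    by (rule filterlim_compose[OF Si_at_top]) (rule filterlim_tendsto_pos_mult_at_top[OF tendsto_const assms filterlim_ident])
  have "isCont (\<lambda>x. Si (c * x)) 0"
    by (rule isCont_o2[where f = "\<lambda>x. c * x" and g = Si, OF _ isCont_Si]) (intro continuous_intros)
  then have "((\<lambda>x. Si (c * x)) \<longlongrightarrow> Si (c * 0)) (at 0)" by (simp add: isCont_def)
  moreover have "Si 0 = 0" unfolding Si_alt_def zero_ereal_def[symmetric] by (rule interval_integral_endpoints_same)
  ultimately show "((\<lambda>x. Si (c * x)) \<longlongrightarrow> 0) (at_right 0)"
    by (simp add: filterlim_at_split)
qed

lemma DERIV_Si_scale:
  assumes "c > 0" "x > 0"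
  shows "((\<lambda>x. Si (c * x)) has_real_derivative (sin (c * x) / x)) (at x)"
proof -
  have "((\<lambda>x. Si (c * x)) has_real_derivative (sinc (c * x) * c)) (at x)"
    by (rule DERIV_chain2[where f = Si, OF DERIV_Si]) (auto intro!: derivative_eq_intros)
  moreover have "sinc (c * x) * c = sin (c * x) / x" using assms by (auto simp: field_simps)
  ultimately show ?thesis by simp
qed

lemma has_bochner_integral_sin2:
  "has_bochner_integral lborel (\<lambda>x. (sin x)\<^sup>2 / x\<^sup>2) pi"
proof -
  define S2 where "S2 = (\<lambda>x. Si (2 * x))"
  have S2: "(S2 has_real_derivative (sin (2 * x) / x)) (at x)" if "x > 0" for x
    unfolding S2_def using that by (intro DERIV_Si_scale) auto
  have l2: "(S2 \<longlongrightarrow> pi / 2) at_top" "(S2 \<longlongrightarrow> 0) (at_right 0)"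
    unfolding S2_def using Si_scale_lim[of 2] by auto
  \<comment> \<open>One integration by parts: the boundary term is
    \<open>- (sin x)\<^sup>2 / x\<close>, and differentiating the squared sine leaves
    \<open>sin (2 * x) / x\<close>, whose primitive is \<open>S2\<close>.\<close>
  define F where "F = (\<lambda>x. S2 x - (sin x)\<^sup>2 / x)"
  have "has_bochner_integral lborel (\<lambda>x. (sin x)\<^sup>2 / x\<^sup>2) (2 * (pi / 2))"
  proof (rule has_bochner_integral_even_FTC[where F=F])
    fix x :: real assume "0 < x"
    then show "(F has_real_derivative (sin x)\<^sup>2 / x\<^sup>2) (at x)"
      unfolding F_def using sin_double[of x]
      by (auto intro!: derivative_eq_intros S2 simp: field_simps power2_eq_square)
  next
    have "((\<lambda>x. (sin x)\<^sup>2 / x) \<longlongrightarrow> 0) (at_right (0::real))" by real_asymp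
    from tendsto_diff[OF l2(2) this] show "(F \<longlongrightarrow> 0) (at_right 0)" by (simp add: F_def)
    have "((\<lambda>x. (sin x)\<^sup>2 / x) \<longlongrightarrow> 0) (at_top :: real filter)" by real_asymp
    from tendsto_diff[OF l2(1) this] show "(F \<longlongrightarrow> pi / 2) at_top" by (simp add: F_def)
  qed auto
  then show ?thesis by simp
qed

text \<open>Since sin^4 x = sin^2 x - sin^2(2x)/4, this is the previous integral minus its copy
  rescaled by 2, which is half as large.\<close>

lemma has_bochner_integral_sin4_2:
  "has_bochner_integral lborel (\<lambda>x. (sin x)^4 / x\<^sup>2) (pi / 2)"
proof -
  have "has_bochner_integral lborel (\<lambda>x. (sin (2 * x))\<^sup>2 / (2 * x)\<^sup>2) (pi / 2)"
    using lborel_has_bochner_integral_real_affine_iff[of 2 "\<lambda>x. (sin x)\<^sup>2 / x\<^sup>2" pi 0] has_bochner_integral_sin2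
    by simp
  from has_bochner_integral_diff[OF has_bochner_integral_sin2 this]
  have "has_bochner_integral lborel (\<lambda>x. (sin x)\<^sup>2 / x\<^sup>2 - (sin (2 * x))\<^sup>2 / (2 * x)\<^sup>2) (pi / 2)"
    by simp
  also have "(\<lambda>x::real. (sin x)\<^sup>2 / x\<^sup>2 - (sin (2 * x))\<^sup>2 / (2 * x)\<^sup>2) = (\<lambda>x. (sin x)^4 / x\<^sup>2)"
  proof
    fix x :: real
    have "(sin x)\<^sup>2 / x\<^sup>2 - (sin (2 * x))\<^sup>2 / (2 * x)\<^sup>2 = ((sin x)\<^sup>2 - (sin x)\<^sup>2 * (cos x)\<^sup>2) / x\<^sup>2"
      unfolding sin_double by (simp add: power_mult_distrib diff_divide_distrib)
    also have "(sin x)\<^sup>2 - (sin x)\<^sup>2 * (cos x)\<^sup>2 = (sin x)^4"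
      unfolding cos_squared_eq by (simp add: algebra_simps power4_eq_xxxx power2_eq_square)
    finally show "(sin x)\<^sup>2 / x\<^sup>2 - (sin (2 * x))\<^sup>2 / (2 * x)\<^sup>2 = (sin x)^4 / x\<^sup>2" .
  qed
  finally show ?thesis .
qed

lemma has_bochner_integral_sin4_4:
  "has_bochner_integral lborel (\<lambda>x. (sin x)^4 / x^4) (2 * pi / 3)"
proof -
  define S2 S4 where "S2 = (\<lambda>x. Si (2 * x))" and "S4 = (\<lambda>x. Si (4 * x))"
  have S2: "(S2 has_real_derivative (sin (2 * x) / x)) (at x)" if "x > 0" for x
    unfolding S2_def using that by (intro DERIV_Si_scale) auto
  have S4: "(S4 has_real_derivative (sin (4 * x) / x)) (at x)" if "x > 0" for x
    unfolding S4_def using that by (intro DERIV_Si_scale) auto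
  have l2: "(S2 \<longlongrightarrow> pi / 2) at_top" "(S2 \<longlongrightarrow> 0) (at_right 0)"
    unfolding S2_def using Si_scale_lim[of 2] by auto
  have l4: "(S4 \<longlongrightarrow> pi / 2) at_top" "(S4 \<longlongrightarrow> 0) (at_right 0)"
    unfolding S4_def using Si_scale_lim[of 4] by auto
  \<comment> \<open>Three integrations by parts lower the denominator from \<open>x^4\<close> to
    \<open>x\<close>. \<open>R\<close> collects the boundary terms; what is left is a combination of
    \<open>sin (2 * x) / x\<close> and \<open>sin (4 * x) / x\<close>, with primitives
    \<open>S2\<close> and \<open>S4\<close>.\<close>
  define R where "R = (\<lambda>x::real. (2/3) * ((sin x)\<^sup>2 - (sin (2 * x))\<^sup>2) / x - (2/3) * (sin x)^3 * cos x / x\<^sup>2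
    - (sin x)^4 / (3 * x^3))"
  define F where "F = (\<lambda>x. (2/3) * (2 * S4 x - S2 x) + R x)"
  have "has_bochner_integral lborel (\<lambda>x. (sin x)^4 / x^4) (2 * (pi / 3))"
  proof (rule has_bochner_integral_even_FTC[where F=F])
    fix x :: real assume x: "0 < x"
    define s c where "s = sin x" and "c = cos x"
    have sc: "c\<^sup>2 = 1 - s\<^sup>2" by (simp add: s_def c_def cos_squared_eq)
    have 1: "((\<lambda>x. (2/3) * ((sin x)\<^sup>2 - (sin (2 * x))\<^sup>2) / x) has_real_derivative
       (2/3) * ((sin (2 * x) - 2 * sin (4 * x)) / x - ((sin x)\<^sup>2 - (sin (2 * x))\<^sup>2) / x\<^sup>2)) (at x)"
      apply (rule derivative_eq_intros refl | use x in simp; fail)+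
      using x sin_double[of "2*x"] sin_double[of x]
      by (simp add: divide_simps; simp add: algebra_simps power2_eq_square)
    have 2: "((\<lambda>x. (2/3) * (sin x)^3 * cos x / x\<^sup>2) has_real_derivative
       (2/3) * ((3 * (sin x)\<^sup>2 * (cos x)\<^sup>2 - (sin x)^4) / x\<^sup>2 - 2 * (sin x)^3 * cos x / x^3)) (at x)"
      apply (rule derivative_eq_intros refl | use x in simp; fail)+
      using x by (simp add: divide_simps) (simp add: eval_nat_numeral algebra_simps)
    have 3: "((\<lambda>x. (sin x)^4 / (3 * x^3)) has_real_derivative
       (4 * (sin x)^3 * cos x / (3 * x^3) - (sin x)^4 / x^4)) (at x)"
      apply (rule derivative_eq_intros refl | use x in simp; fail)+
      using x by (simp add: divide_simps) (simp add: eval_nat_numeral algebra_simps)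
    have "(F has_real_derivative ((2/3) * (2 * (sin (4 * x) / x) - sin (2 * x) / x) +
        ((2/3) * ((sin (2 * x) - 2 * sin (4 * x)) / x - ((sin x)\<^sup>2 - (sin (2 * x))\<^sup>2) / x\<^sup>2)
        - (2/3) * ((3 * (sin x)\<^sup>2 * (cos x)\<^sup>2 - (sin x)^4) / x\<^sup>2 - 2 * (sin x)^3 * cos x / x^3)
        - (4 * (sin x)^3 * cos x / (3 * x^3) - (sin x)^4 / x^4)))) (at x)"
      unfolding F_def R_def
      by (intro DERIV_add DERIV_diff DERIV_cmult 1 2 3 S2 S4 x)
    also have "((2/3) * (2 * (sin (4 * x) / x) - sin (2 * x) / x) +
        ((2/3) * ((sin (2 * x) - 2 * sin (4 * x)) / x - ((sin x)\<^sup>2 - (sin (2 * x))\<^sup>2) / x\<^sup>2)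
        - (2/3) * ((3 * (sin x)\<^sup>2 * (cos x)\<^sup>2 - (sin x)^4) / x\<^sup>2 - 2 * (sin x)^3 * cos x / x^3)
        - (4 * (sin x)^3 * cos x / (3 * x^3) - (sin x)^4 / x^4)))
      = (sin x)^4 / x^4 - (2/3) * ((sin x)\<^sup>2 - (sin (2 * x))\<^sup>2 + 3 * (sin x)\<^sup>2 * (cos x)\<^sup>2 - (sin x)^4) / x\<^sup>2"
      by (simp add: diff_divide_distrib add_divide_distrib algebra_simps)
    also have "(sin x)\<^sup>2 - (sin (2 * x))\<^sup>2 + 3 * (sin x)\<^sup>2 * (cos x)\<^sup>2 - (sin x)^4 = 0"
    proof -
      have "(sin x)\<^sup>2 - (sin (2 * x))\<^sup>2 + 3 * (sin x)\<^sup>2 * (cos x)\<^sup>2 - (sin x)^4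
        = s\<^sup>2 - s\<^sup>2 * c\<^sup>2 - s^4"
        by (simp add: sin_double power_mult_distrib s_def c_def)
      also have "\<dots> = 0" unfolding sc by (simp add: algebra_simps power4_eq_xxxx power2_eq_square)
      finally show ?thesis .
    qed
    finally show "(F has_real_derivative (sin x)^4 / x^4) (at x)" by simp
  next
    have "(R \<longlongrightarrow> 0) (at_right (0::real))" unfolding R_def by real_asymp
    from tendsto_add[OF tendsto_mult_left[where c = "2/3", OF tendsto_diff[OF tendsto_mult_left[where c = 2, OF l4(2)] l2(2)]] this]
    show "(F \<longlongrightarrow> 0) (at_right 0)" by (simp add: F_def)
    have "(R \<longlongrightarrow> 0) at_top" unfolding R_def by real_asymp
    from tendsto_add[OF tendsto_mult_left[where c = "2/3", OF tendsto_diff[OF tendsto_mult_left[where c = 2, OF l4(1)] l2(1)]] this]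
    show "(F \<longlongrightarrow> pi / 3) at_top" by (simp add: F_def)
  qed auto
  then show ?thesis by simp
qed

text \<open>The common prefactor of K and H: it has period 1, vanishes exactly at the integers, and
  \<open>sin2 x / x\<^sup>2\<close> is K off 0.\<close>

definition sin2 :: "real \<Rightarrow> real" where "sin2 x = (sin (pi * x) / pi)\<^sup>2"

lemma has_bochner_integral_scale_pi:
  fixes f :: "real \<Rightarrow> real"
  assumes "has_bochner_integral lborel f I"
  shows "has_bochner_integral lborel (\<lambda>x. f (pi * x)) (I / pi)"
  using lborel_has_bochner_integral_real_affine_iff[of pi f I 0] assms by (simp add: divide_inverse mult.commute)

lemma sin2_integrals:
  shows has_bochner_integral_K: "has_bochner_integral lborel (\<lambda>x. sin2 x / x\<^sup>2) 1"
    and has_bochner_integral_sin2sq: "has_bochner_integral lborel (\<lambda>x. (sin2 x)\<^sup>2 / x\<^sup>2) (1 / (2 * pi\<^sup>2))"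
    and has_bochner_integral_K2: "has_bochner_integral lborel (\<lambda>x. (sin2 x)\<^sup>2 / x^4) (2 / 3)"
proof -
  have "has_bochner_integral lborel (\<lambda>x. c * (f (pi * x))) (c * (I / pi))"
    if "has_bochner_integral lborel f I" for c I and f :: "real \<Rightarrow> real"
    by (intro has_bochner_integral_mult_right has_bochner_integral_scale_pi that)
  note * = this
  have eq: "sin2 x / x\<^sup>2 = 1 * ((sin (pi * x))\<^sup>2 / (pi * x)\<^sup>2)"
    "(sin2 x)\<^sup>2 / x\<^sup>2 = 1 / pi\<^sup>2 * ((sin (pi * x)) ^ 4 / (pi * x)\<^sup>2)"
    "(sin2 x)\<^sup>2 / x ^ 4 = 1 * ((sin (pi * x)) ^ 4 / (pi * x) ^ 4)" for x
    unfolding sin2_def by (simp_all add: eval_nat_numeral mult_ac)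
  show "has_bochner_integral lborel (\<lambda>x. sin2 x / x\<^sup>2) 1"
    using *[OF has_bochner_integral_sin2, of 1] unfolding eq by simp
  show "has_bochner_integral lborel (\<lambda>x. (sin2 x)\<^sup>2 / x\<^sup>2) (1 / (2 * pi\<^sup>2))"
    using *[OF has_bochner_integral_sin4_2, of "1 / pi\<^sup>2"] unfolding eq by (simp add: mult.commute)
  show "has_bochner_integral lborel (\<lambda>x. (sin2 x)\<^sup>2 / x^4) (2 / 3)"
    using *[OF has_bochner_integral_sin4_4, of 1] unfolding eq by simp
qed

lemma sin2_nonneg [simp]: "0 \<le> sin2 x"
  by (simp add: sin2_def)

lemma sin2_le: "sin2 x \<le> 1 / pi\<^sup>2"
  by (simp add: sin2_def power_divide divide_right_mono abs_square_le_1)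

lemma sin2_minus [simp]: "sin2 (- x) = sin2 x"
  by (simp add: sin2_def)

lemma sin2_add_1 [simp]: "sin2 (x + 1) = sin2 x" "sin2 (1 + x) = sin2 x" "sin2 (x - 1) = sin2 x" "sin2 (1 - x) = sin2 x"
  by (simp_all add: sin2_def algebra_simps sin_diff power2_eq_square)

lemma sin2_le_sq: "sin2 x \<le> x\<^sup>2"
proof -
  have "\<bar>sin (pi * x)\<bar> \<le> \<bar>pi * x\<bar>" by (rule abs_sin_x_le_abs_x)
  then have "(sin (pi * x))\<^sup>2 \<le> (pi * x)\<^sup>2" by (simp only: abs_le_square_iff)
  then show ?thesis by (simp add: sin2_def power_divide power_mult_distrib field_simps)
qed

lemma sin2_eq_0_iff: "sin2 x = 0 \<longleftrightarrow> x \<in> \<int>"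
  by (simp add: sin2_def sin_zero_iff_int2 mult.commute[of pi] Ints_def image_iff)

lemma sin2_borel [measurable]: "sin2 \<in> borel_measurable borel"
  unfolding sin2_def by measurable

subsection \<open>The function \<open>H\<close> on the real line\<close>

text \<open>For \<open>x > 0\<close> one has \<open>1 - H(x) = sin2 x * W_sum x\<close>; each term of the sum is
  \<open>(1/(x + m) - 1/(x + m + 1))\<^sup>2\<close>.\<close>

definition W_term :: "real \<Rightarrow> nat \<Rightarrow> real" where
  "W_term x m = 1 / ((x + real m)\<^sup>2 * (x + real m + 1)\<^sup>2)"

definition W_sum :: "real \<Rightarrow> real" where "W_sum x = suminf (W_term x)"

lemma W_sum_borel [measurable]: "W_sum \<in> borel_measurable borel"
  unfolding W_sum_def W_term_def by measurable

text \<open>Expanding the square of 1/y - 1/(y + 1) gives two shifted copies of the trigamma series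
  and a cross term that telescopes.\<close>

lemma W_term_sums_Polygamma:
  assumes "0 < x"
  shows "W_term x sums (2 * Polygamma 1 x - 1 / x\<^sup>2 - 2 / x)"
proof -
  have P: "(\<lambda>m. 1 / (x + real m)\<^sup>2) sums Polygamma 1 x"
    using Polygamma_LIMSEQ[of x 1] assms by (simp add: inverse_eq_divide power2_eq_square)
  then have Q: "(\<lambda>m. 1 / (x + real (Suc m))\<^sup>2) sums (Polygamma 1 x - 1 / x\<^sup>2)"
    by (subst sums_Suc_iff) simp
  have "(\<lambda>m. 1 / (x + real m)) \<longlonglongrightarrow> 0"
    by real_asymp
  from telescope_sums'[OF this] have R: "(\<lambda>m. 1 / (x + real m) - 1 / (x + real (Suc m))) sums (1 / x)"
    by simp
  have "(\<lambda>m. 1 / (x + real m)\<^sup>2 + 1 / (x + real (Suc m))\<^sup>2 - 2 * (1 / (x + real m) - 1 / (x + real (Suc m))))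
    sums (Polygamma 1 x + (Polygamma 1 x - 1 / x\<^sup>2) - 2 * (1 / x))"
    by (intro sums_diff sums_add sums_mult P Q R)
  moreover have "1 / (x + real m)\<^sup>2 + 1 / (x + real (Suc m))\<^sup>2 - 2 * (1 / (x + real m) - 1 / (x + real (Suc m)))
    = W_term x m" for m
  proof -
    define y where "y = x + real m"
    have "y > 0" using assms by (simp add: y_def)
    then have "1 / y\<^sup>2 + 1 / (y + 1)\<^sup>2 - 2 * (1 / y - 1 / (y + 1)) = 1 / (y\<^sup>2 * (y + 1)\<^sup>2)"
      by (simp add: divide_simps) (simp add: algebra_simps power2_eq_square)
    then show ?thesis by (simp add: W_term_def y_def add_ac)
  qed
  ultimately show ?thesis by (simp add: algebra_simps)
qed

lemma W_sum_eq_Polygamma: "0 < x \<Longrightarrow> W_sum x = 2 * Polygamma 1 x - 1 / x\<^sup>2 - 2 / x"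
  unfolding W_sum_def using W_term_sums_Polygamma by (metis sums_unique)

lemma W_sum_rec:
  assumes "0 < x"
  shows "W_sum x = 1 / (x\<^sup>2 * (x + 1)\<^sup>2) + W_sum (x + 1)"
proof -
  have P: "Polygamma 1 (x + 1) = Polygamma 1 x - 1 / x\<^sup>2"
    using Polygamma_plus1[of x 1] assms by (simp add: power2_eq_square)
  have "1 / (x\<^sup>2 * (x + 1)\<^sup>2) = 1 / x\<^sup>2 - 2 / x + 1 / (x + 1)\<^sup>2 + 2 / (x + 1)"
    using assms by (simp add: divide_simps) (simp add: algebra_simps power2_eq_square)
  then show ?thesis using assms P by (simp add: W_sum_eq_Polygamma del: One_nat_def)
qed

text \<open>Each term lies between the increments of \<open>1/y\<^sup>2 - 1/(y(y + c))\<close> for \<open>c = 1/3\<close> and \<open>c = 1/2\<close>.\<close>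

lemma
  assumes "0 < x"
  shows W_sum_le: "W_sum x \<le> 1 / x\<^sup>2 - 1 / (x * (x + 1/2))"
    and W_sum_ge: "1 / x\<^sup>2 - 1 / (x * (x + 1/3)) \<le> W_sum x"
proof -
  have W: "W_term x sums W_sum x"
    using W_term_sums_Polygamma[OF assms] W_sum_eq_Polygamma[OF assms] by simp
  define f where "f c m = 1 / (x + real m)\<^sup>2 - 1 / ((x + real m) * (x + real m + c))" for c m
  have f: "(\<lambda>m. f c m - f c (Suc m)) sums (f c 0)" for c
  proof -
    have "f c \<longlonglongrightarrow> 0" unfolding f_def by real_asymp
    from telescope_sums'[OF this] show ?thesis by simp
  qed
  have le: "W_term x m \<le> f (1/2) m - f (1/2) (Suc m)" for m
  proof -
    define y where "y = x + real m"
    have y: "y > 0" using assms by (simp add: y_def)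
    have "1 / (y\<^sup>2 * (y + 1)\<^sup>2) \<le> (1 / y\<^sup>2 - 1 / (y * (y + 1/2))) - (1 / (y+1)\<^sup>2 - 1 / ((y + 1) * (y + 1 + 1/2)))"
      using y by (simp add: divide_simps) (simp add: algebra_simps power2_eq_square)
    then show ?thesis by (simp add: W_term_def f_def y_def add_ac)
  qed
  have ge: "f (1/3) m - f (1/3) (Suc m) \<le> W_term x m" for m
  proof -
    define y where "y = x + real m"
    have y: "y > 0" using assms by (simp add: y_def)
    have "(1 / y\<^sup>2 - 1 / (y * (y + 1/3))) - (1 / (y+1)\<^sup>2 - 1 / ((y + 1) * (y + 1 + 1/3))) \<le> 1 / (y\<^sup>2 * (y + 1)\<^sup>2)"
      using y by (simp add: divide_simps) (simp add: algebra_simps power2_eq_square)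
    then show ?thesis by (simp add: W_term_def f_def y_def add_ac)
  qed
  show "W_sum x \<le> 1 / x\<^sup>2 - 1 / (x * (x + 1/2))"
    using sums_le[OF le W f] by (simp add: f_def)
  show "1 / x\<^sup>2 - 1 / (x * (x + 1/3)) \<le> W_sum x"
    using sums_le[OF ge f W] by (simp add: f_def)
qed

section \<open>Reflection formulas, from the gamma to the trigamma function\<close>

lemma Gamma_reflection_real:
  fixes x :: real
  shows "Gamma x * Gamma (1 - x) = pi / sin (pi * x)"
proof -
  have "complex_of_real (Gamma x * Gamma (1 - x)) = Gamma (of_real x) * Gamma (of_real (1 - x))"
    by (simp only: of_real_mult Gamma_complex_of_real)
  also have "\<dots> = Gamma (of_real x) * Gamma (1 - of_real x)"
    by (simp only: of_real_diff of_real_1)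
  also have "\<dots> = of_real pi / sin (of_real (pi * x))"
    by (simp only: Gamma_reflection_complex of_real_mult)
  also have "\<dots> = of_real (pi / sin (pi * x))"
    by (simp only: sin_of_real of_real_divide)
  finally show ?thesis by (simp only: of_real_eq_iff)
qed

text \<open>Logarithmic differentiation of the gamma reflection formula; differentiating once more
  gives the trigamma version.\<close>

lemma Digamma_reflection:
  assumes "0 < x" "x < (1::real)"
  shows "Digamma x - Digamma (1 - x) = - pi * cot (pi * x)"
proof -
  have nz: "x \<notin> \<int>\<^sub>\<le>\<^sub>0" "1 - x \<notin> \<int>\<^sub>\<le>\<^sub>0" using assms by (auto elim!: nonpos_Ints_cases)
  have s: "sin (pi * x) > 0" using assms by (intro sin_gt_zero) auto
  have 1: "((\<lambda>x. Gamma x * Gamma (1 - x)) has_real_derivative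
      Gamma x * Gamma (1 - x) * (Digamma x - Digamma (1 - x))) (at x)"
    using nz by (auto intro!: derivative_eq_intros simp: algebra_simps)
  have 2: "((\<lambda>x. pi / sin (pi * x)) has_real_derivative - (pi * (cos (pi * x) * pi)) / (sin (pi * x))\<^sup>2) (at x)"
    using s by (auto intro!: derivative_eq_intros simp: power2_eq_square)
  have "pi / sin (pi * x) * (Digamma x - Digamma (1 - x)) = - (pi * (cos (pi * x) * pi)) / (sin (pi * x))\<^sup>2"
    using DERIV_unique[OF 1[unfolded Gamma_reflection_real] 2] .
  then have "sin (pi * x) / pi * (pi / sin (pi * x) * (Digamma x - Digamma (1 - x)))
      = sin (pi * x) / pi * (- (pi * (cos (pi * x) * pi)) / (sin (pi * x))\<^sup>2)" by simp
  then show ?thesis using s by (simp add: cot_def power2_eq_square)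
qed

lemma Polygamma_1_reflection:
  assumes "0 < x" "x < (1::real)"
  shows "Polygamma 1 x + Polygamma 1 (1 - x) = 1 / sin2 x"
proof -
  have nz: "x \<notin> \<int>\<^sub>\<le>\<^sub>0" "1 - x \<notin> \<int>\<^sub>\<le>\<^sub>0" using assms by (auto elim!: nonpos_Ints_cases)
  have s: "sin (pi * x) > 0" using assms by (intro sin_gt_zero) auto
  have 1: "((\<lambda>x. Digamma x - Digamma (1 - x)) has_real_derivative
      Polygamma 1 x + Polygamma 1 (1 - x)) (at x)"
    using nz by (auto intro!: derivative_eq_intros)
  have "((\<lambda>x. - pi * cot (pi * x)) has_real_derivative pi * pi / (sin (pi * x))\<^sup>2) (at x)"
    using s by (auto intro!: derivative_eq_intros DERIV_chain2[where f = cot, OF DERIV_cot] simp: field_simps)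
  then have 2: "((\<lambda>x. Digamma x - Digamma (1 - x)) has_real_derivative pi * pi / (sin (pi * x))\<^sup>2) (at x)"
    by (rule has_field_derivative_transform_within_open[where S = "{0<..<1}"])
      (use assms Digamma_reflection in auto)
  show ?thesis
    using DERIV_unique[OF 1 2] by (simp add: sin2_def power_divide power2_eq_square)
qed

text \<open>The trigamma reflection in terms of \<open>W_sum\<close>, whose rational corrections at
  x and 1 - x combine by partial fractions. It serves the unit step of H that crosses 0.\<close>

lemma W_sum_reflection:
  assumes "0 < x" "x < (1::real)"
  shows "sin2 x * (W_sum x + W_sum (1 - x)) = 2 - sin2 x / (x\<^sup>2 * (1 - x)\<^sup>2)"
proof -
  have s: "sin2 x \<noteq> 0" using assms by (auto simp: sin2_eq_0_iff elim!: Ints_cases)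
  have "W_sum x + W_sum (1 - x) = 2 / sin2 x - 1 / (x\<^sup>2 * (1 - x)\<^sup>2)"
  proof -
    have "W_sum x + W_sum (1 - x) = 2 * (Polygamma 1 x + Polygamma 1 (1 - x))
       - (1 / x\<^sup>2 + 2 / x + 1 / (1 - x)\<^sup>2 + 2 / (1 - x))"
      using assms by (simp add: W_sum_eq_Polygamma)
    also have "1 / x\<^sup>2 + 2 / x + 1 / (1 - x)\<^sup>2 + 2 / (1 - x) = 1 / (x\<^sup>2 * (1 - x)\<^sup>2)"
      using assms by (simp add: divide_simps) (simp add: algebra_simps power2_eq_square)
    finally show ?thesis using Polygamma_1_reflection[OF assms] by simp
  qed
  then show ?thesis using s by (simp add: field_simps)
qed

text \<open>On (0, 1) this is the trigamma reflection formula. Induction on the integer part extends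
  it: moving x to x + 1 puts one new term in front of the series, which the trigamma recurrence
  supplies, while \<open>sin2\<close> does not change.\<close>

lemma sums_inverse_squares_left:
  assumes "0 < x" "x \<notin> \<int>"
  shows "(\<lambda>n. 1 / (x - real (Suc n))\<^sup>2) sums (1 / sin2 x - Polygamma 1 x)"
proof -
  have *: "(\<lambda>n. 1 / (y + real k - real (Suc n))\<^sup>2) sums (1 / sin2 y - Polygamma 1 (y + real k))"
    if y: "0 < y" "y < 1" for y k
  proof (induction k)
    case 0
    have "(\<lambda>n. 1 / (1 - y + real n)\<^sup>2) sums Polygamma 1 (1 - y)"
      using Polygamma_LIMSEQ[of "1 - y" 1] y by (simp add: inverse_eq_divide power2_eq_square)
    moreover have "(1 - y + real n)\<^sup>2 = (y - real (Suc n))\<^sup>2" for n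
      by (simp add: power2_eq_square algebra_simps)
    ultimately show ?case using Polygamma_1_reflection[OF y, symmetric] by (simp del: of_nat_Suc)
  next
    case (Suc k)
    let ?f = "\<lambda>n. 1 / (y + real (Suc k) - real (Suc n))\<^sup>2"
    have "(\<lambda>n. ?f (Suc n)) sums (1 / sin2 y - Polygamma 1 (y + real k))"
      using Suc by (simp add: algebra_simps)
    then have "?f sums (1 / sin2 y - Polygamma 1 (y + real k) + ?f 0)"
      by (subst (asm) sums_Suc_iff) simp
    moreover have "Polygamma 1 (y + real (Suc k)) = Polygamma 1 (y + real k) - 1 / (y + real k)\<^sup>2"
      using Polygamma_plus1[of "y + real k" 1] y by (simp add: power2_eq_square add_ac)
    moreover have "1 / sin2 y - Polygamma 1 (y + real k) + ?f 0 = 1 / sin2 y - (Polygamma 1 (y + real k) - 1 / (y + real k)\<^sup>2)"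
      by simp
    ultimately show ?case by (simp only:)
  qed
  define k where "k = nat \<lfloor>x\<rfloor>"
  define y where "y = frac x"
  have "y \<noteq> 0" using assms by (simp add: y_def frac_eq_0_iff)
  then have y: "0 < y" "y < 1" unfolding y_def
    using frac_ge_0[of x] frac_lt_1[of x] by linarith+
  have x: "x = y + real k" using assms by (simp add: y_def k_def frac_def)
  have per: "sin2 (y + real n) = sin2 y" for n
  proof (induction n)
    case (Suc n)
    then show ?case using sin2_add_1(1)[of "y + real n"] by (simp add: add_ac del: sin2_add_1)
  qed simp
  show ?thesis using *[OF y, of k] unfolding x per .
qed

text \<open>The terms over positive m and over negative m have constant sign each, so the two
  ordinary series are also unordered sums and may be added; the term m = 0 vanishes because sgn 0 =
  0.\<close>

lemma infsum_sgn_inverse_squares: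
  assumes "0 < x" "x \<notin> \<int>"
  shows "(\<Sum>\<^sub>\<infinity>m\<in>(UNIV :: int set). of_int (sgn m) / (x - of_int m)\<^sup>2)
    = 1 / sin2 x - 2 * Polygamma 1 x + 1 / x\<^sup>2"
proof -
  let ?f = "\<lambda>m::int. of_int (sgn m) / (x - of_int m)\<^sup>2"
  define p n where "p = (\<lambda>k. int (Suc k))" and "n = (\<lambda>k. - int (Suc k))"
  have "((\<lambda>k. 1 / (x - real (Suc k))\<^sup>2) has_sum (1 / sin2 x - Polygamma 1 x)) UNIV"
    by (rule sums_nonneg_imp_has_sum[OF sums_inverse_squares_left[OF assms]]) simp
  moreover have "inj p" by (auto simp: p_def inj_on_def)
  ultimately have P: "(?f has_sum (1 / sin2 x - Polygamma 1 x)) (range p)"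
    by (subst has_sum_reindex) (simp_all add: p_def o_def)
  have "(\<lambda>m. 1 / (x + real m)\<^sup>2) sums Polygamma 1 x"
    using Polygamma_LIMSEQ[of x 1] assms by (simp add: inverse_eq_divide power2_eq_square)
  then have "(\<lambda>m. 1 / (x + real (Suc m))\<^sup>2) sums (Polygamma 1 x - 1 / x\<^sup>2)"
    by (subst sums_Suc_iff) simp
  then have "((\<lambda>m. 1 / (x + real (Suc m))\<^sup>2) has_sum (Polygamma 1 x - 1 / x\<^sup>2)) UNIV"
    by (rule sums_nonneg_imp_has_sum) simp
  then have "((\<lambda>m. - (1 / (x + real (Suc m))\<^sup>2)) has_sum - (Polygamma 1 x - 1 / x\<^sup>2)) UNIV"
    by (subst has_sum_uminus) simp
  moreover have "inj n" by (auto simp: n_def inj_on_def)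
  moreover have n: "x - of_int (n m) = x + real (Suc m)" "sgn (n m) = - 1" for m
    by (simp_all add: n_def)
  have "?f \<circ> n = (\<lambda>m. - (1 / (x + real (Suc m))\<^sup>2))"
    unfolding o_def n by simp
  ultimately have N: "(?f has_sum - (Polygamma 1 x - 1 / x\<^sup>2)) (range n)"
    by (subst has_sum_reindex) simp_all
  have "(?f has_sum (1 / sin2 x - Polygamma 1 x + - (Polygamma 1 x - 1 / x\<^sup>2))) (range p \<union> range n)"
    by (rule has_sum_Un_disjoint[OF P N]) (auto simp: p_def n_def)
  moreover have "(?f has_sum s) (range p \<union> range n) \<longleftrightarrow> (?f has_sum s) UNIV" for s
  proof (rule has_sum_cong_neutral)
    fix m :: int
    assume m: "m \<in> UNIV - (range p \<union> range n)"
    have "m = 0"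
    proof (rule ccontr)
      assume "m \<noteq> 0"
      then have "m = p (nat (m - 1)) \<or> m = n (nat (- m - 1))" by (auto simp: p_def n_def)
      with m show False by blast
    qed
    then show "?f m = 0" by simp
  qed auto
  ultimately show ?thesis by (simp add: infsumI)
qed

section \<open>From the bilateral series to a closed form for H\<close>

lemma H_formula_minus: "H_formula (- x) = - H_formula (x :: real)"
proof -
  have "(\<Sum>\<^sub>\<infinity>m\<in>(UNIV :: int set). of_int (sgn m) / (- x - of_int m)\<^sup>2)
     = (\<Sum>\<^sub>\<infinity>m\<in>uminus ` (UNIV :: int set). of_int (sgn m) / (- x - of_int m)\<^sup>2)"
    by simp
  also have "\<dots> = (\<Sum>\<^sub>\<infinity>m\<in>(UNIV :: int set). of_int (sgn (- m)) / (- x - of_int (- m))\<^sup>2)"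
    by (subst infsum_reindex) (simp_all add: o_def)
  also have "\<dots> = (\<Sum>\<^sub>\<infinity>m\<in>(UNIV :: int set). - (of_int (sgn m) / (x - of_int m)\<^sup>2))"
    by (intro infsum_cong) (simp add: sgn_minus power2_commute)
  also have "\<dots> = - (\<Sum>\<^sub>\<infinity>m\<in>(UNIV :: int set). of_int (sgn m) / (x - of_int m)\<^sup>2)"
    by (rule infsum_uminus)
  finally show ?thesis by (simp add: H_formula_def algebra_simps)
qed

text \<open>A closed form extended to negative arguments by oddness. Agreement with
  \<open>H_fun\<close> is established only off the integers, which is enough for integrals and
  avoids computing the limits there.\<close>

definition H_real :: "real \<Rightarrow> real" where
  "H_real x = sgn x * (1 - sin2 x * W_sum \<bar>x\<bar>)"

lemma H_real_minus: "H_real (- x) = - H_real x"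
  by (simp add: H_real_def sgn_minus)

lemma H_real_borel [measurable]: "H_real \<in> borel_measurable borel"
  unfolding H_real_def by measurable

lemma H_fun_eq:
  assumes "x \<notin> \<int>"
  shows "H_fun x = H_real x"
proof -
  have pos: "H_formula y = H_real y" if "y > 0" "y \<notin> \<int>" for y :: real
  proof -
    have "sin2 y \<noteq> 0" using that by (simp add: sin2_eq_0_iff)
    then show ?thesis
      using that unfolding H_formula_def infsum_sgn_inverse_squares[OF that]
      by (simp add: H_real_def W_sum_eq_Polygamma sin2_def[symmetric]) (simp add: field_simps)
  qed
  have "x \<noteq> 0" using assms by auto
  moreover have "H_formula x = H_real x" if "x < 0"
    using pos[of "- x"] that assms minus_in_Ints_iff[of x] by (simp add: H_formula_minus H_real_minus)
  ultimately have "H_formula x = H_real x" using pos[of x] assms by (cases x "0::real" rule: linorder_cases) auto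
  then show ?thesis using assms by (simp add: H_fun_def)
qed

text \<open>For y > 0 the step is the first term of \<open>W_sum\<close>, and y < -1 follows by
  oddness. For -1 < y < 0 the jump of \<open>sgn\<close> at 0 contributes 2, which
  \<open>W_sum_reflection\<close> cancels.\<close>

lemma H_real_step:
  assumes "y \<notin> \<int>"
  shows "H_real (y + 1) - H_real y = sin2 y / (y\<^sup>2 * (y + 1)\<^sup>2)"
proof -
  have pos: "H_real (z + 1) - H_real z = sin2 z / (z\<^sup>2 * (z + 1)\<^sup>2)" if "z > 0" for z
    using that W_sum_rec[OF that] by (simp add: H_real_def algebra_simps)
  have ne: "y \<noteq> 0" "y \<noteq> - 1" using assms by (auto simp del: minus_in_Ints_iff)
  consider "y > 0" | "y < -1" | "-1 < y" "y < 0" using ne by linarith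
  then show ?thesis
  proof cases
    case 1 then show ?thesis by (rule pos)
  next
    case 2
    have "H_real (y + 1) - H_real y = H_real (- 1 - y + 1) - H_real (- 1 - y)"
      using H_real_minus[of "y + 1"] H_real_minus[of y] by (simp add: algebra_simps)
    also have "\<dots> = sin2 (- 1 - y) / ((- 1 - y)\<^sup>2 * (- 1 - y + 1)\<^sup>2)" using 2 by (intro pos) auto
    also have "\<dots> = sin2 y / (y\<^sup>2 * (y + 1)\<^sup>2)"
      using sin2_minus[of "1 + y"] by (simp add: power2_eq_square algebra_simps)
    finally show ?thesis .
  next
    case 3
    define z where "z = - y"
    have z: "0 < z" "z < 1" using 3 by (auto simp: z_def)
    have "H_real (y + 1) - H_real y = H_real (1 - z) + H_real z"
      by (simp add: z_def H_real_minus add.commute)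
    also have "\<dots> = 2 - sin2 z * (W_sum z + W_sum (1 - z))"
      using z by (simp add: H_real_def algebra_simps)
    also have "\<dots> = sin2 z / (z\<^sup>2 * (1 - z)\<^sup>2)" using W_sum_reflection[OF z] by simp
    also have "\<dots> = sin2 y / (y\<^sup>2 * (y + 1)\<^sup>2)" by (simp add: z_def add.commute)
    finally show ?thesis .
  qed
qed

subsection \<open>The integral of \<open>1 - H\<^sup>2\<close>\<close>

text \<open>Here \<open>K_real 0 = 0\<close> because of division by zero; the correct value \<open>1\<close> is irrelevant for integrals.\<close>

definition K_real :: "real \<Rightarrow> real" where "K_real x = sin2 x / x\<^sup>2"

lemma K_real_nonneg [simp]: "0 \<le> K_real x"
  by (simp add: K_real_def)

lemma K_real_minus [simp]: "K_real (- x) = K_real x"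
  by (simp add: K_real_def)

lemma K_real_le_1: "K_real x \<le> 1"
  using sin2_le_sq[of x] by (simp add: K_real_def divide_le_eq_1)

lemma K_real_borel [measurable]: "K_real \<in> borel_measurable borel"
  unfolding K_real_def by measurable

lemma K_real_integral: "has_bochner_integral lborel K_real 1"
  using has_bochner_integral_K unfolding K_real_def .

lemma K_real_integrable [simp]: "integrable lborel K_real"
  using K_real_integral has_bochner_integral_iff by blast

lemma integrable_K_bound:
  assumes "f \<in> borel_measurable borel" and "\<And>x. \<bar>f x\<bar> \<le> c * K_real x"
  shows "integrable lborel f"
proof (rule Bochner_Integration.integrable_bound)
  show "integrable lborel (\<lambda>x. c * K_real x)" by simp
  show "AE x in lborel. norm (f x) \<le> norm (c * K_real x)"
    using assms(2) by (intro AE_I2) (metis abs_ge_self order_trans real_norm_def)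
qed (use assms in simp)

lemma has_bochner_integral_odd:
  fixes f :: "real \<Rightarrow> real"
  assumes "integrable lborel f" "\<And>x. f (- x) = - f x"
  shows "has_bochner_integral lborel f 0"
proof -
  have "(\<integral>x. f x \<partial>lborel) = (\<integral>x. f (0 - x) \<partial>lborel)" by (rule lborel_integral_reflect[symmetric])
  also have "\<dots> = - (\<integral>x. f x \<partial>lborel)" using assms(2) by simp
  finally show ?thesis using assms(1) by (simp add: has_bochner_integral_iff)
qed

text \<open>\<open>u\<close> may decay only like 1/y, so the integral cannot be split over the whole
  line. Truncated to [-n, n] it can; after a shift only two unit intervals near -n and n survive,
  where |u| is O(1/n).\<close>

lemma integral_telescoping_difference:
  fixes u :: "real \<Rightarrow> real"
  assumes u [measurable]: "u \<in> borel_measurable borel"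
    and bound: "\<And>y. \<bar>y\<bar> * \<bar>u y\<bar> \<le> C"
    and int: "integrable lborel (\<lambda>y. u y - u (y + 1))"
    and loc: "\<And>y. \<bar>u y\<bar> \<le> C"
  shows "has_bochner_integral lborel (\<lambda>y. u y - u (y + 1)) 0"
proof -
  define X where "X n = (\<lambda>y. indicator {- real n..real n} y :: real)" for n :: nat
  have [measurable]: "X n \<in> borel_measurable borel" for n unfolding X_def by measurable
  have lim: "(\<lambda>n. \<integral>y. X n y * (u y - u (y + 1)) \<partial>lborel) \<longlonglongrightarrow> (\<integral>y. u y - u (y + 1) \<partial>lborel)"
  proof (rule integral_dominated_convergence[where w = "\<lambda>y. \<bar>u y - u (y + 1)\<bar>"])
    show "AE y in lborel. (\<lambda>n. X n y * (u y - u (y + 1))) \<longlonglongrightarrow> u y - u (y + 1)"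
    proof (intro AE_I2)
      fix y :: real
      have "eventually (\<lambda>n. X n y * (u y - u (y + 1)) = u y - u (y + 1)) sequentially"
        using eventually_ge_at_top[of "nat \<lceil>\<bar>y\<bar>\<rceil>"]
      proof eventually_elim
        case (elim n)
        then have "\<bar>y\<bar> \<le> real n" by linarith
        then show ?case by (simp add: X_def abs_le_iff)
      qed
      then show "(\<lambda>n. X n y * (u y - u (y + 1))) \<longlonglongrightarrow> u y - u (y + 1)"
        by (rule tendsto_eventually)
    qed
    show "AE y in lborel. norm (X n y * (u y - u (y + 1))) \<le> \<bar>u y - u (y + 1)\<bar>" for n
      by (intro AE_I2) (simp add: X_def split: split_indicator)
  qed (use int in simp_all)
  have small: "\<bar>\<integral>y. X n y * (u y - u (y + 1)) \<partial>lborel\<bar> \<le> 2 * C / (real n - 1)" if n: "n \<ge> 2" for n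
  proof -
    have ind: "integrable lborel (\<lambda>y. indicator {a..b} y * C)" for a b :: real
      by (intro integrable_mult_left integrable_real_indicator) (simp_all add: emeasure_lborel_Icc_eq)
    have loc': "\<bar>u y\<bar> \<le> \<bar>C\<bar>" for y
      using loc[of y] by linarith
    have i1: "integrable lborel (\<lambda>y. X n y * u y)"
      by (rule Bochner_Integration.integrable_bound[OF ind[of "- real n" "real n"]])
        (use loc' in \<open>auto simp: X_def split: split_indicator\<close>)
    have i2: "integrable lborel (\<lambda>y. X n y * u (y + 1))"
      by (intro Bochner_Integration.integrable_bound[OF ind[of "- real n" "real n"]])
        (use loc' in \<open>auto simp: X_def split: split_indicator\<close>)
    have i3: "integrable lborel (\<lambda>y. X n (y - 1) * u y)"
      using lborel_integrable_shift[OF i2, of "-1"] by simp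
    have "(\<integral>y. X n y * (u y - u (y + 1)) \<partial>lborel) = (\<integral>y. X n y * u y \<partial>lborel) - (\<integral>y. X n y * u (y + 1) \<partial>lborel)"
      using i1 i2 by (simp add: right_diff_distrib)
    also have "(\<integral>y. X n y * u (y + 1) \<partial>lborel) = (\<integral>y. X n (y - 1) * u y \<partial>lborel)"
      using lborel_integral_shift[of "\<lambda>y. X n y * u (y + 1)" "-1"] by simp
    also have "(\<integral>y. X n y * u y \<partial>lborel) - \<dots> = (\<integral>y. (X n y - X n (y - 1)) * u y \<partial>lborel)"
      using i1 i3 by (simp add: left_diff_distrib)
    finally have eq: "(\<integral>y. X n y * (u y - u (y + 1)) \<partial>lborel) = (\<integral>y. (X n y - X n (y - 1)) * u y \<partial>lborel)" .
    \<comment> \<open>The indicators of [-n, n] and of its translate [-n + 1, n + 1] differ only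
      inside these two unit intervals, on which |y| \<ge> n - 1.\<close>
    define J where "J = (\<lambda>y. (C / (real n - 1)) * (indicator {- real n..- real n + 1} y + indicator {real n..real n + 1} y))"
    have J: "has_bochner_integral lborel J (C / (real n - 1) * (1 + 1))"
      unfolding J_def
      by (intro has_bochner_integral_mult_right has_bochner_integral_add)
        (simp_all add: has_bochner_integral_iff emeasure_lborel_Icc_eq)
    have le: "\<bar>(X n y - X n (y - 1)) * u y\<bar> \<le> J y" for y
    proof (cases "\<bar>y\<bar> \<ge> real n - 1")
      case True
      then have "(real n - 1) * \<bar>u y\<bar> \<le> C" using bound[of y]
        by (meson abs_ge_zero mult_right_mono order_trans)
      then have "\<bar>u y\<bar> \<le> C / (real n - 1)" using n by (simp add: field_simps)
      moreover have "C \<ge> 0" using loc[of 0] by linarith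
      ultimately show ?thesis using n by (auto simp: X_def J_def split: split_indicator)
    next
      case False
      then have "X n y = 1" "X n (y - 1) = 1" using n by (auto simp: X_def not_le abs_less_iff)
      moreover have "J y \<ge> 0" using loc[of 0] n by (auto simp: J_def split: split_indicator)
      ultimately show ?thesis by simp
    qed
    have "\<bar>\<integral>y. (X n y - X n (y - 1)) * u y \<partial>lborel\<bar> \<le> (\<integral>y. J y \<partial>lborel)"
      using J le by (intro integral_abs_bound_integral) (auto simp: has_bochner_integral_iff left_diff_distrib i1 i3)
    also have "\<dots> = 2 * C / (real n - 1)" using J by (simp add: has_bochner_integral_iff)
    finally show ?thesis by (simp only: eq)
  qed
  have "(\<lambda>n. \<integral>y. X n y * (u y - u (y + 1)) \<partial>lborel) \<longlonglongrightarrow> 0"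
  proof (rule Lim_null_comparison)
    show "eventually (\<lambda>n. norm (\<integral>y. X n y * (u y - u (y + 1)) \<partial>lborel) \<le> 2 * C / (real n - 1)) sequentially"
      using eventually_ge_at_top[of 2] by eventually_elim (use small in simp)
    show "(\<lambda>n. 2 * C / (real n - 1)) \<longlonglongrightarrow> 0" by real_asymp
  qed
  from LIMSEQ_unique[OF lim this] int show ?thesis by (simp add: has_bochner_integral_iff)
qed

lemma abs_mult_le_sum_squares: "\<bar>a * b\<bar> \<le> a\<^sup>2 + (b::real)\<^sup>2"
proof -
  have "2 * (\<bar>a\<bar> * \<bar>b\<bar>) \<le> a\<^sup>2 + b\<^sup>2"
    using sum_squares_bound[of "\<bar>a\<bar>" "\<bar>b\<bar>"] by simp
  moreover have "0 \<le> \<bar>a\<bar> * \<bar>b\<bar>" by simp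
  ultimately show ?thesis unfolding abs_mult by linarith
qed

text \<open>As \<open>sin2\<close> has period 1, partial fractions turn the integrand into
  \<open>u y - u (y + 1)\<close> with \<open>u y = (sin2 y)\<^sup>2 / y\<close>. At the poles both
  sides are 0, since \<open>sin2\<close> vanishes there and division by 0 gives 0.\<close>

lemma has_bochner_integral_sin2sq_cross:
  "has_bochner_integral lborel (\<lambda>y. (sin2 y)\<^sup>2 / (y * (y + 1))) 0"
proof -
  define u where "u = (\<lambda>y. (sin2 y)\<^sup>2 / y)"
  have eq: "u y - u (y + 1) = (sin2 y)\<^sup>2 / (y * (y + 1))" for y
  proof (cases "y = 0 \<or> y = - 1")
    case True
    moreover have "sin2 0 = 0" "sin2 1 = 0" by (simp_all add: sin2_def)
    ultimately show ?thesis by (auto simp: u_def)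
  next
    case False
    then have "y \<noteq> 0" "y + 1 \<noteq> 0" by auto
    then show ?thesis by (simp add: u_def divide_simps) (simp add: algebra_simps)
  qed
  have s1: "(sin2 y)\<^sup>2 \<le> 1" for y
  proof -
    have "1 \<le> pi\<^sup>2" using pi_ge_two by (intro one_le_power) linarith
    then have "1 / pi\<^sup>2 \<le> 1" by simp
    then have "sin2 y \<le> 1" using sin2_le[of y] by linarith
    then show ?thesis by (simp add: power_le_one)
  qed
  have "\<bar>u y\<bar> \<le> 1" for y
  proof (cases "\<bar>y\<bar> \<le> 1")
    case True
    have "(sin2 y)\<^sup>2 \<le> (y\<^sup>2)\<^sup>2" using sin2_le_sq[of y] by (intro power_mono) auto
    also have "\<dots> = \<bar>y\<bar> * \<bar>y\<bar>^3" by (simp add: power2_eq_square power3_eq_cube abs_mult_self_eq mult_ac)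
    also have "\<dots> \<le> \<bar>y\<bar> * 1" using True by (intro mult_left_mono power_le_one) auto
    finally show ?thesis by (cases "y = 0") (simp_all add: u_def abs_divide divide_le_eq)
  next
    case False
    then show ?thesis using s1[of y] by (simp add: u_def abs_divide divide_le_eq)
  qed
  moreover have "\<bar>y\<bar> * \<bar>u y\<bar> \<le> 1" for y
    using s1[of y] by (simp add: u_def abs_divide)
  moreover have "integrable lborel (\<lambda>y. u y - u (y + 1))"
    unfolding eq
  proof (rule Bochner_Integration.integrable_bound)
    show "integrable lborel (\<lambda>y. (sin2 y)\<^sup>2 / y\<^sup>2 + (sin2 (y + 1))\<^sup>2 / (y + 1)\<^sup>2)"
      using has_bochner_integral_sin2sq lborel_has_bochner_integral_shift[OF has_bochner_integral_sin2sq, of 1]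
      by (intro Bochner_Integration.integrable_add) (auto simp: has_bochner_integral_iff)
    show "AE y in lborel. norm ((sin2 y)\<^sup>2 / (y * (y + 1))) \<le> norm ((sin2 y)\<^sup>2 / y\<^sup>2 + (sin2 (y + 1))\<^sup>2 / (y + 1)\<^sup>2)"
    proof (intro AE_I2)
      fix y :: real
      have "\<bar>(1 / y) * (1 / (y + 1))\<bar> \<le> (1 / y)\<^sup>2 + (1 / (y + 1))\<^sup>2"
        by (rule abs_mult_le_sum_squares)
      then have "(sin2 y)\<^sup>2 * \<bar>(1 / y) * (1 / (y + 1))\<bar> \<le> (sin2 y)\<^sup>2 * ((1 / y)\<^sup>2 + (1 / (y + 1))\<^sup>2)"
        by (intro mult_left_mono) auto
      then show "norm ((sin2 y)\<^sup>2 / (y * (y + 1))) \<le> norm ((sin2 y)\<^sup>2 / y\<^sup>2 + (sin2 (y + 1))\<^sup>2 / (y + 1)\<^sup>2)"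
        by (simp add: abs_mult abs_divide power_divide distrib_left)
    qed
  qed measurable
  moreover have "u \<in> borel_measurable borel" unfolding u_def by measurable
  ultimately have "has_bochner_integral lborel (\<lambda>y. u y - u (y + 1)) 0"
    by (intro integral_telescoping_difference[where C = 1])
  then show ?thesis unfolding eq .
qed

text \<open>Partial fractions of 1/(y^4 (y + 1)^2). The two simple poles have opposite residues and
  are paired into the cross term of integral 0; the cubic term is odd, and the others are the known
  integrals of powers of the sine.\<close>

lemma integral_K_step:
  "(\<integral>y. K_real y * (sin2 y / (y\<^sup>2 * (y + 1)\<^sup>2)) \<partial>lborel) = 2 / 3 + 2 / pi\<^sup>2"
proof -
  note i2 = has_bochner_integral_sin2sq and i4 = has_bochner_integral_K2 
  have i3: "has_bochner_integral lborel (\<lambda>y. (sin2 y)\<^sup>2 / y^3) 0"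
  proof (rule has_bochner_integral_odd)
    show "integrable lborel (\<lambda>y. (sin2 y)\<^sup>2 / y^3)"
    proof (rule Bochner_Integration.integrable_bound)
      show "integrable lborel (\<lambda>y. (sin2 y)\<^sup>2 / y\<^sup>2 + (sin2 y)\<^sup>2 / y^4)"
        using i2 i4 by (auto simp: has_bochner_integral_iff)
      show "AE y in lborel. norm ((sin2 y)\<^sup>2 / y^3) \<le> norm ((sin2 y)\<^sup>2 / y\<^sup>2 + (sin2 y)\<^sup>2 / y^4)"
      proof (intro AE_I2)
        fix y :: real
        have "\<bar>1 / y^3\<bar> \<le> (1 / y\<^sup>2 + 1 / y^4)"
          using abs_mult_le_sum_squares[of "1/y" "1/y\<^sup>2"]
          by (simp add: power2_eq_square power3_eq_cube power4_eq_xxxx mult_ac)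
        then have "(sin2 y)\<^sup>2 * \<bar>1 / y^3\<bar> \<le> (sin2 y)\<^sup>2 * (1 / y\<^sup>2 + 1 / y^4)"
          by (intro mult_left_mono) auto
        then show "norm ((sin2 y)\<^sup>2 / y^3) \<le> norm ((sin2 y)\<^sup>2 / y\<^sup>2 + (sin2 y)\<^sup>2 / y^4)"
          by (simp add: abs_mult abs_divide distrib_left)
      qed
    qed measurable
  qed (simp add: power3_eq_cube)
  have "has_bochner_integral lborel (\<lambda>y. (sin2 y)\<^sup>2 / y^4 - 2 * ((sin2 y)\<^sup>2 / y^3) + 3 * ((sin2 y)\<^sup>2 / y\<^sup>2)
      + (sin2 (y + 1))\<^sup>2 / (y + 1)\<^sup>2 - 4 * ((sin2 y)\<^sup>2 / (y * (y + 1))))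
    (2 / 3 - 2 * 0 + 3 * (1 / (2 * pi\<^sup>2)) + 1 / (2 * pi\<^sup>2) - 4 * 0)"
    by (intro has_bochner_integral_add has_bochner_integral_diff has_bochner_integral_mult_right i2 i3 i4
        has_bochner_integral_sin2sq_cross lborel_has_bochner_integral_shift[OF i2])
  moreover have "(sin2 y)\<^sup>2 / y^4 - 2 * ((sin2 y)\<^sup>2 / y^3) + 3 * ((sin2 y)\<^sup>2 / y\<^sup>2)
      + (sin2 (y + 1))\<^sup>2 / (y + 1)\<^sup>2 - 4 * ((sin2 y)\<^sup>2 / (y * (y + 1)))
      = K_real y * (sin2 y / (y\<^sup>2 * (y + 1)\<^sup>2))" for y
  proof (cases "y = 0 \<or> y = - 1")
    case True
    moreover have "sin2 0 = 0" "sin2 1 = 0" by (simp_all add: sin2_def)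
    ultimately show ?thesis by auto
  next
    case False
    then have y: "y \<noteq> 0" "y + 1 \<noteq> 0" by auto
    have "1 / y^4 - 2 * (1 / y^3) + 3 * (1 / y\<^sup>2) + 1 / (y + 1)\<^sup>2 - 4 * (1 / (y * (y + 1)))
      = 1 / (y\<^sup>2 * (y\<^sup>2 * (y + 1)\<^sup>2))"
      using y by (simp add: divide_simps) (simp add: algebra_simps eval_nat_numeral)
    then have "(sin2 y)\<^sup>2 * (1 / y^4 - 2 * (1 / y^3) + 3 * (1 / y\<^sup>2) + 1 / (y + 1)\<^sup>2 - 4 * (1 / (y * (y + 1))))
      = (sin2 y)\<^sup>2 * (1 / (y\<^sup>2 * (y\<^sup>2 * (y + 1)\<^sup>2)))" by simp
    then show ?thesis by (simp add: K_real_def algebra_simps) (simp add: power2_eq_square)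
  qed
  ultimately show ?thesis by (simp add: has_bochner_integral_iff)
qed

lemma sin2_W_sum_bounds:
  assumes "x > 0"
  shows "0 \<le> sin2 x * W_sum x" "sin2 x * W_sum x \<le> K_real x / (2 * x + 1)" "sin2 x * W_sum x \<le> 1"
proof -
  have "1 / (x * (x + 1/3)) < 1 / x\<^sup>2"
    unfolding power2_eq_square using assms by (intro divide_strict_left_mono mult_strict_left_mono) auto
  with W_sum_ge[OF assms] show "0 \<le> sin2 x * W_sum x"
    by (intro mult_nonneg_nonneg) auto
  have "sin2 x * W_sum x \<le> sin2 x * (1 / x\<^sup>2 - 1 / (x * (x + 1/2)))"
    by (intro mult_left_mono W_sum_le assms) auto
  also have "1 / x\<^sup>2 - 1 / (x * (x + 1/2)) = 1 / x\<^sup>2 / (2 * x + 1)"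
    using assms by (simp add: divide_simps power2_eq_square)
  finally show 2: "sin2 x * W_sum x \<le> K_real x / (2 * x + 1)" by (simp add: K_real_def)
  also have "\<dots> \<le> 1 / 1" using assms by (intro frac_le K_real_le_1) auto
  finally show "sin2 x * W_sum x \<le> 1" by simp
qed

lemma H_real_bounds: "\<bar>H_real x\<bar> \<le> 1"
proof (cases "x = 0")
  case False
  then show ?thesis using sin2_W_sum_bounds[of "\<bar>x\<bar>"] by (cases "x > 0") (auto simp: H_real_def sgn_if abs_le_iff)
qed (simp add: H_real_def)

text \<open>With |H| = 1 - w one has 1 - H^2 \<le> 2w. The extra denominator beyond K gives cubic
  decay, so that the function stays integrable after multiplication by a linear weight.\<close>

lemma one_minus_H_sq_bounds:
  assumes "x \<noteq> 0"
  shows "0 \<le> 1 - (H_real x)\<^sup>2" "1 - (H_real x)\<^sup>2 \<le> K_real x / (\<bar>x\<bar> + 1/2)"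
proof -
  show "0 \<le> 1 - (H_real x)\<^sup>2" using H_real_bounds[of x] by (simp add: abs_square_le_1)
  define w where "w = sin2 \<bar>x\<bar> * W_sum \<bar>x\<bar>"
  have s: "sin2 \<bar>x\<bar> = sin2 x" by (cases "x > 0") auto
  have "(sgn x)\<^sup>2 = 1" using assms by (simp add: power2_eq_square flip: sgn_mult)
  then have "(H_real x)\<^sup>2 = (1 - w)\<^sup>2" by (simp add: H_real_def w_def s power_mult_distrib)
  also have "\<dots> \<ge> 1 - 2 * w" by (simp add: power2_diff)
  finally have "1 - (H_real x)\<^sup>2 \<le> 2 * w" by simp
  also have "w \<le> K_real \<bar>x\<bar> / (2 * \<bar>x\<bar> + 1)" using assms sin2_W_sum_bounds(2)[of "\<bar>x\<bar>"] by (simp add: w_def)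
  also have "2 * \<dots> = K_real x / (\<bar>x\<bar> + 1/2)" by (simp add: K_real_def s field_simps)
  finally show "1 - (H_real x)\<^sup>2 \<le> K_real x / (\<bar>x\<bar> + 1/2)" by simp
qed

lemma AE_not_Ints: "AE x in lborel. (x::real) \<notin> \<int>"
  by (intro AE_not_in countable_imp_null_set_lborel countable_int)

lemma integral_one_minus_H_sq:
  "has_bochner_integral lborel (\<lambda>x. 1 - (H_real x)\<^sup>2) (2 / 3 + 2 / pi\<^sup>2)"
proof -
  \<comment> \<open>The value at 0 is reset because \<open>H_real 0\<close> and
    \<open>K_real 0\<close> are both 0, so the bound by \<open>K_real\<close> would fail
    there.\<close>
  define f where "f = (\<lambda>x. if x = 0 then 0 else 1 - (H_real x)\<^sup>2)"
  have [measurable]: "f \<in> borel_measurable borel" unfolding f_def by measurable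
  have b: "0 \<le> f x" "f x \<le> K_real x / (\<bar>x\<bar> + 1/2)" for x
    using one_minus_H_sq_bounds[of x] by (auto simp: f_def)
  have if0: "integrable lborel f"
  proof (rule integrable_K_bound[where c = 2])
    fix x
    have "K_real x / (\<bar>x\<bar> + 1/2) \<le> K_real x / (1 / 2)" by (intro divide_left_mono) auto
    then show "\<bar>f x\<bar> \<le> 2 * K_real x" using b[of x] by simp
  qed measurable
  have if1: "integrable lborel (\<lambda>x. (x + c) * f x)" if "\<bar>c\<bar> \<le> 1/2" for c
  proof (rule integrable_K_bound[where c = 1])
    fix x
    have "\<bar>(x + c) * f x\<bar> \<le> (\<bar>x\<bar> + 1/2) * (K_real x / (\<bar>x\<bar> + 1/2))"
      unfolding abs_mult using that b[of x] by (intro mult_mono) auto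
    also have "\<dots> = K_real x" by (simp add: field_simps add_pos_nonneg)
    finally show "\<bar>(x + c) * f x\<bar> \<le> 1 * K_real x" by simp
  qed measurable
  have iKH: "integrable lborel (\<lambda>x. K_real x * H_real (x + c))" for c
  proof (rule integrable_K_bound[where c = 1])
    show "\<bar>K_real x * H_real (x + c)\<bar> \<le> 1 * K_real x" for x
      using mult_left_mono[OF H_real_bounds[of "x + c"] K_real_nonneg[of x]] by (simp add: abs_mult)
  qed measurable
  \<comment> \<open>As \<open>K_real\<close> is even and \<open>H_real\<close> odd, this is an odd
    function of the shift \<open>c\<close>.\<close>
  define KH where "KH c = (\<integral>x. K_real x * H_real (x + c) \<partial>lborel)" for c
  have KH_minus: "KH (- c) = - KH c" for c
  proof -
    have "KH (- c) = (\<integral>x. K_real (0 - x) * H_real (0 - x + - c) \<partial>lborel)"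
      unfolding KH_def by (rule lborel_integral_reflect[symmetric])
    also have "\<dots> = (\<integral>x. - (K_real x * H_real (x + c)) \<partial>lborel)"
      using H_real_minus[of "_ + c"] by simp
    finally show ?thesis by (simp add: KH_def)
  qed
  have KH0: "KH 0 = 0" using KH_minus[of 0] by simp
  have shift: "has_bochner_integral lborel (\<lambda>y. K_real (y + 1) * H_real (y + c)) (KH (c - 1))" for c
    using lborel_has_bochner_integral_shift[of "\<lambda>x. K_real x * H_real (x + (c - 1))" "KH (c - 1)" 1] iKH
    by (simp add: has_bochner_integral_iff KH_def)
  have noshift: "has_bochner_integral lborel (\<lambda>y. K_real y * H_real (y + c)) (KH c)" for c
    using iKH by (simp add: has_bochner_integral_iff KH_def)
  \<comment> \<open>Summation by parts: the weight 1 is written as (x + 1/2) - (x - 1/2), and the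
    second integral is shifted by 1 so that both weights become y + 1/2.\<close>
  have "(\<integral>x. f x \<partial>lborel) = (\<integral>x. (x + 1/2) * f x - (x + - (1/2)) * f x \<partial>lborel)"
    by (simp add: algebra_simps)
  also have "\<dots> = (\<integral>x. (x + 1/2) * f x \<partial>lborel) - (\<integral>x. (x + - (1/2)) * f x \<partial>lborel)"
    by (intro Bochner_Integration.integral_diff if1) auto
  also have "(\<integral>x. (x + - (1/2)) * f x \<partial>lborel) = (\<integral>x. (x + 1 + - (1/2)) * f (x + 1) \<partial>lborel)"
    by (rule lborel_integral_shift[symmetric])
  also have "(\<integral>x. (x + 1/2) * f x \<partial>lborel) - \<dots> = (\<integral>x. (x + 1/2) * f x - (x + 1 + - (1/2)) * f (x + 1) \<partial>lborel)"
    by (intro Bochner_Integration.integral_diff[symmetric] if1 lborel_integrable_shift[OF if1, of _ 1]) auto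
  also have "\<dots> = (\<integral>y. (K_real y * H_real (y + 0) + K_real y * H_real (y + 1)
      - K_real (y + 1) * H_real (y + 0) - K_real (y + 1) * H_real (y + 1)) / 2 \<partial>lborel)"
  proof (rule integral_cong_AE)
    show "AE y in lborel. (y + 1/2) * f y - (y + 1 + - (1/2)) * f (y + 1)
      = (K_real y * H_real (y + 0) + K_real y * H_real (y + 1)
      - K_real (y + 1) * H_real (y + 0) - K_real (y + 1) * H_real (y + 1)) / 2"
      using AE_not_Ints
    proof eventually_elim
      fix y :: real assume "y \<notin> \<int>"
      then have ne: "y \<noteq> 0" "y + 1 \<noteq> 0" by (auto simp: add_eq_0_iff2)
      define D where "D = sin2 y / (y\<^sup>2 * (y + 1)\<^sup>2)"
      have D: "H_real (y + 1) = H_real y + D" using H_real_step[OF \<open>y \<notin> \<int>\<close>] by (simp add: D_def)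
      \<comment> \<open>The weight 2y + 1 converts the step of H into the decrement of K, so no
        polynomial factor remains.\<close>
      have "1 / y\<^sup>2 - 1 / (y + 1)\<^sup>2 = (2 * y + 1) / (y\<^sup>2 * (y + 1)\<^sup>2)"
        using ne by (simp add: divide_simps) (simp add: algebra_simps power2_eq_square)
      then have "sin2 y * (1 / y\<^sup>2 - 1 / (y + 1)\<^sup>2) = sin2 y * ((2 * y + 1) / (y\<^sup>2 * (y + 1)\<^sup>2))" by simp
      then have K: "K_real y - K_real (y + 1) = (2 * y + 1) * D"
        by (simp add: K_real_def D_def right_diff_distrib)
      have "(y + 1/2) * f y - (y + 1 + - (1/2)) * f (y + 1) = (y + 1/2) * ((H_real (y + 1))\<^sup>2 - (H_real y)\<^sup>2)"
        using ne by (simp add: f_def algebra_simps)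
      also have "\<dots> = ((2 * y + 1) * D) * (H_real y + H_real (y + 1)) / 2"
        unfolding D by (simp add: algebra_simps power2_eq_square)
      also have "\<dots> = (K_real y * H_real (y + 0) + K_real y * H_real (y + 1)
      - K_real (y + 1) * H_real (y + 0) - K_real (y + 1) * H_real (y + 1)) / 2"
        unfolding K[symmetric] by (simp add: algebra_simps)
      finally show "(y + 1/2) * f y - (y + 1 + - (1/2)) * f (y + 1)
      = (K_real y * H_real (y + 0) + K_real y * H_real (y + 1)
      - K_real (y + 1) * H_real (y + 0) - K_real (y + 1) * H_real (y + 1)) / 2" .
    qed
  qed measurable
  also have "\<dots> = (KH 0 + KH 1 - KH (0 - 1) - KH (1 - 1)) / 2"
    by (intro has_bochner_integral_integral_eq has_bochner_integral_divide_zero has_bochner_integral_add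
        has_bochner_integral_diff shift noshift)
  \<comment> \<open>The vanishing \<open>KH 0\<close> is subtracted on purpose: it makes the
    explicit unit step of H reappear under a single integral.\<close>
  also have "\<dots> = KH 1 - KH 0" using KH0 KH_minus[of 1] by simp
  also have "\<dots> = (\<integral>y. K_real y * H_real (y + 1) - K_real y * H_real (y + 0) \<partial>lborel)"
    unfolding KH_def by (intro Bochner_Integration.integral_diff[symmetric] iKH)
  also have "\<dots> = (\<integral>y. K_real y * (sin2 y / (y\<^sup>2 * (y + 1)\<^sup>2)) \<partial>lborel)"
  proof (rule integral_cong_AE)
    show "AE y in lborel. K_real y * H_real (y + 1) - K_real y * H_real (y + 0) = K_real y * (sin2 y / (y\<^sup>2 * (y + 1)\<^sup>2))"
      using AE_not_Ints 
      by eventually_elim (subst H_real_step[symmetric], assumption, simp add: right_diff_distrib)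
  qed measurable
  finally have "(\<integral>x. f x \<partial>lborel) = 2 / 3 + 2 / pi\<^sup>2" unfolding integral_K_step .
  then have "has_bochner_integral lborel f (2 / 3 + 2 / pi\<^sup>2)"
    using if0 by (simp add: has_bochner_integral_iff)
  moreover have "AE x in lborel. f x = 1 - (H_real x)\<^sup>2"
    using AE_lborel_singleton[of 0] by eventually_elim (simp add: f_def)
  ultimately show ?thesis
    using has_bochner_integral_cong_AE[of f lborel "\<lambda>x. 1 - (H_real x)\<^sup>2"] by simp
qed

subsection \<open>Pointwise bounds for \<open>B - sgn\<close>\<close>

lemma sin_taylor_5: "\<bar>sin x - (x - x^3 / 6 + x^5 / 120)\<bar> \<le> \<bar>x\<bar>^7 / 5040" for x :: real
proof -
  have "(\<Sum>m<7. sin_coeff m * x ^ m) = x - x^3 / 6 + x^5 / 120"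
    by (simp add: lessThan_nat_numeral sin_coeff_def fact_numeral)
  then show ?thesis using Maclaurin_sin_bound[of x 7] by (simp add: fact_numeral)
qed

lemma sin_taylor_7: "\<bar>sin x - (x - x^3 / 6 + x^5 / 120 - x^7 / 5040)\<bar> \<le> \<bar>x\<bar>^8 / 40320" for x :: real
proof -
  have "(\<Sum>m<8. sin_coeff m * x ^ m) = x - x^3 / 6 + x^5 / 120 - x^7 / 5040"
    by (simp add: lessThan_nat_numeral sin_coeff_def fact_numeral)
  then show ?thesis using Maclaurin_sin_bound[of x 8] by (simp add: fact_numeral)
qed

text \<open>Taylor bounds place the sine of the rational candidate on the correct side of sin(pi/6)
  = 1/2, and monotonicity compares the arguments. The precision is set by the six decimals claimed
  for \<open>c_const\<close>.\<close>

lemma pi_gt: "3.14159 < pi"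
proof -
  define x where "x = (3.14159 :: real) / 6"
  have "sin x \<le> (x - x^3 / 6 + x^5 / 120 - x^7 / 5040) + \<bar>x\<bar>^8 / 40320"
    using sin_taylor_7[of x] by linarith
  also have "\<dots> < 1 / 2" by (simp add: x_def field_simps)
  also have "1 / 2 = sin (pi / 6)" by (simp add: sin_30)
  finally have "sin x < sin (pi / 6)" .
  moreover have "x \<le> pi / 2" using pi_ge_two by (simp add: x_def)
  ultimately have "x < pi / 6" using sin_mono_less_eq[of x "pi / 6"] pi_ge_two by (simp add: x_def)
  then show ?thesis by (simp add: x_def)
qed

lemma pi_lt: "pi < 3.141595"
proof -
  define x where "x = (3.141595 :: real) / 6"
  have "sin (pi / 6) = 1 / 2" by (simp add: sin_30)
  also have "\<dots> < (x - x^3 / 6 + x^5 / 120 - x^7 / 5040) - \<bar>x\<bar>^8 / 40320" by (simp add: x_def field_simps)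
  also have "\<dots> \<le> sin x" using sin_taylor_7[of x] by linarith
  finally have "sin (pi / 6) < sin x" .
  then have "pi / 6 < x" using sin_mono_less_eq[of "pi / 6" x] pi_gt by (simp add: x_def)
  then show ?thesis by (simp add: x_def)
qed

lemma pi_sq_bounds: "9.869525 < pi\<^sup>2" "pi\<^sup>2 < 9.86962"
proof -
  have "(3.14159 :: real)\<^sup>2 < pi\<^sup>2" using pi_gt by (intro power_strict_mono) auto
  then show "9.869525 < pi\<^sup>2" by (simp add: power2_eq_square)
  have "pi\<^sup>2 < (3.141595 :: real)\<^sup>2" using pi_lt by (intro power_strict_mono) auto
  then show "pi\<^sup>2 < 9.86962" by (simp add: power2_eq_square)
qed

text \<open>Both sides are symmetric under u -> 1 - u, so u \<le> 1/2 suffices; there the Taylor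
  bound with rational estimates for the powers of pi^2 leaves a polynomial inequality.\<close>

lemma sin_pi_div_pi_le:
  assumes "0 \<le> u" "u \<le> 1"
  shows "sin (pi * u) / pi \<le> u * (1 - u) * (1 + 6/5 * (u * (1 - u)))"
proof -
  have half: "sin (pi * u) / pi \<le> u * (1 - u) * (1 + 6/5 * (u * (1 - u)))" if u: "0 \<le> u" "u \<le> 1/2" for u
  proof -
    define p where "p = pi\<^sup>2"
    have p: "394781/40000 < p" "p < 493481/50000" using pi_sq_bounds by (simp_all add: p_def)
    have p2: "p * p \<le> 4871/50" using p mult_strict_mono[OF p(2) p(2)] by simp
    have p3: "p * p * p \<le> 962" using p p2 mult_mono[OF p2 less_imp_le[OF p(2)]] by simp
    have "sin (pi * u) \<le> pi * u - (pi * u)^3 / 6 + (pi * u)^5 / 120 + \<bar>pi * u\<bar>^7 / 5040"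
      using sin_taylor_5[of "pi * u"] by linarith
    also have "\<bar>pi * u\<bar> = pi * u" using u by simp
    finally have "sin (pi * u) / pi \<le> (pi * u - (pi * u)^3 / 6 + (pi * u)^5 / 120 + (pi * u)^7 / 5040) / pi"
      by (simp add: divide_right_mono)
    also have "\<dots> = u - p * u^3 / 6 + p * p * u^5 / 120 + p * p * p * u^7 / 5040"
      by (simp add: p_def power_mult_distrib diff_divide_distrib add_divide_distrib eval_nat_numeral mult_ac)
    also have "\<dots> \<le> u - 394781/40000 * u^3 / 6 + 4871/50 * u^5 / 120 + 962 * u^7 / 5040"
    proof -
      have "394781/40000 * u^3 \<le> p * u^3" "p * p * u^5 \<le> 4871/50 * u^5" "p * p * p * u^7 \<le> 962 * u^7"
        using p p2 p3 u by (intro mult_right_mono; simp)+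
      then show ?thesis by linarith
    qed
    also have "\<dots> \<le> u * (1 - u) * (1 + 6/5 * (u * (1 - u)))"
    proof -
      \<comment> \<open>The difference of the two polynomials divided by u^2. With u \<le> 1/2 the
        cubic and quintic terms are absorbed into the quadratic one, and the result dominates a
        positive multiple of (u - 1/2)^2.\<close>
      have "0 \<le> 1/5 - 12/5 * u + 394781/240000 * u + 6/5 * u^2 - 4871/6000 * u^3 - 962/5040 * u^5"
      proof -
        have "u^3 \<le> u^2 / 2" using u mult_right_mono[of u "1/2" "u^2"] by (simp add: power2_eq_square power3_eq_cube)
        moreover have "u^5 \<le> u^2 / 8" 
        proof -
          have "u^3 \<le> (1/2)^3" using u by (intro power_mono) auto
          then have "u^3 * u^2 \<le> (1/2)^3 * u^2" by (intro mult_right_mono) auto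
          then show ?thesis by (simp add: power_add[symmetric] eval_nat_numeral)
        qed
        moreover have "0 \<le> 1/5 - 12/5 * u + 394781/240000 * u + 6/5 * u^2 - 4871/12000 * u^2 - 962/40320 * u^2"
        proof -
          have "0 \<le> (u - 1/2)\<^sup>2 * (6/5 - 4871/12000 - 962 / 40320)" by simp
          then show ?thesis using u by (simp add: power2_eq_square algebra_simps)
        qed
        ultimately show ?thesis by linarith
      qed
      then have "0 \<le> u\<^sup>2 * (1/5 - 12/5 * u + 394781/240000 * u + 6/5 * u^2 - 4871/6000 * u^3 - 962/5040 * u^5)"
        by (intro mult_nonneg_nonneg) auto
      also have "\<dots> = u * (1 - u) * (1 + 6/5 * (u * (1 - u)))
          - (u - 394781/40000 * u^3 / 6 + 4871/50 * u^5 / 120 + 962 * u^7 / 5040)"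
        by (simp add: field_simps eval_nat_numeral)
      finally show ?thesis by simp
    qed
    finally show ?thesis .
  qed
  show ?thesis
  proof (cases "u \<le> 1/2")
    case False
    then have "sin (pi * (1 - u)) / pi \<le> (1 - u) * (1 - (1 - u)) * (1 + 6/5 * ((1 - u) * (1 - (1 - u))))"
      using assms by (intro half) auto
    moreover have "sin (pi * (1 - u)) = sin (pi * u)"
      by (simp add: right_diff_distrib)
    ultimately show ?thesis by (simp add: mult_ac)
  qed (use assms half in auto)
qed

section \<open>The excess of B over the sign function\<close>

definition E_real :: "real \<Rightarrow> real" where "E_real x = K_real x + H_real x - sgn x"

lemma E_real_borel [measurable]: "E_real \<in> borel_measurable borel"
  unfolding E_real_def by measurable

lemma E_real_pos: "0 < x \<Longrightarrow> E_real x = sin2 x * (1 / x\<^sup>2 - W_sum x)"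
  by (simp add: E_real_def K_real_def H_real_def algebra_simps)

lemma E_real_minus: "0 < x \<Longrightarrow> E_real (- x) = K_real x + sin2 x * W_sum x"
  by (simp add: E_real_def H_real_def)

text \<open>Completing x(x + 1/2) to the square (x + 1/4)^2 gives a form suited to the tail
  estimate, where a shift by 1/2 turns 1/4 into 3/4.\<close>

lemma E_real_ge:
  assumes "0 < x"
  shows "sin2 x / (x + 1/4)\<^sup>2 \<le> E_real x"
proof -
  have "1 / (x + 1/4)\<^sup>2 \<le> 1 / (x * (x + 1/2))"
  proof (rule divide_left_mono)
    show "x * (x + 1/2) \<le> (x + 1/4)\<^sup>2" by (simp add: power2_eq_square algebra_simps)
  qed (use assms in auto)
  also have "\<dots> \<le> 1 / x\<^sup>2 - W_sum x" using W_sum_le[OF assms] by simp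
  finally have "sin2 x * (1 / (x + 1/4)\<^sup>2) \<le> sin2 x * (1 / x\<^sup>2 - W_sum x)" by (intro mult_left_mono) auto
  then show ?thesis using assms by (simp add: E_real_pos)
qed

lemma E_real_le:
  assumes "0 < x"
  shows "E_real x \<le> sin2 x / (x * (x + 1/3))"
proof -
  have "sin2 x * (1 / x\<^sup>2 - W_sum x) \<le> sin2 x * (1 / (x * (x + 1/3)))"
    using W_sum_ge[OF assms] by (intro mult_left_mono) auto
  then show ?thesis using assms by (simp add: E_real_pos)
qed

lemma E_real_nonneg: "0 \<le> E_real x"
proof (cases x "0::real" rule: linorder_cases)
  case less
  then show ?thesis using E_real_minus[of "- x"] sin2_W_sum_bounds(1)[of "- x"] by simp
next
  case greater
  then show ?thesis using E_real_ge[of x] by (meson divide_nonneg_nonneg order_trans sin2_nonneg zero_le_power2)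
qed (simp add: E_real_def H_real_def K_real_def)

lemma E_real_minus_le:
  assumes "0 < x"
  shows "E_real (- x) \<le> 2" "1 \<le> x \<Longrightarrow> E_real (- x) \<le> 1 / 7"
proof -
  show "E_real (- x) \<le> 2" using sin2_W_sum_bounds(3)[OF assms] K_real_le_1[of x] by (simp add: E_real_minus assms)
  assume x: "1 \<le> x"
  have "K_real x \<le> (1 / pi\<^sup>2) / 1" unfolding K_real_def by (intro frac_le sin2_le) (use x in auto)
  \<comment> \<open>Chosen so that adding the contribution of \<open>W_sum\<close>, at most a third
    of this for x \<ge> 1, gives exactly 1/7.\<close>
  also have "\<dots> \<le> 3 / 28" using pi_sq_bounds by (simp add: divide_le_eq)
  finally have K: "K_real x \<le> 3 / 28" .
  have "K_real x / (2 * x + 1) \<le> (3/28) / 3" using K x by (intro frac_le) auto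
  then show "E_real (- x) \<le> 1 / 7"
    using K sin2_W_sum_bounds(2)[OF assms] unfolding E_real_minus[OF assms] by linarith
qed

lemma E_real_le_K: "E_real x \<le> 2 * K_real x"
proof (cases x "0::real" rule: linorder_cases)
  case less
  have "K_real (- x) / (2 * (- x) + 1) \<le> K_real (- x) / 1"
    using less by (intro divide_left_mono) auto
  with less show ?thesis using E_real_minus[of "- x"] sin2_W_sum_bounds(2)[of "- x"] by simp
next
  case greater
  then have "E_real x \<le> K_real x"
    using sin2_W_sum_bounds(1)[of x] by (simp add: E_real_pos K_real_def right_diff_distrib)
  then show ?thesis using K_real_nonneg[of x] by linarith
qed (simp add: E_real_def H_real_def K_real_def)

lemma E_real_le_2: "E_real x \<le> 2"
  using E_real_le_K[of x] K_real_le_1[of x] by linarith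

text \<open>The first term of \<open>W_sum\<close> is kept exactly and only the remainder, at x + 1,
  is estimated; with the polynomial bound for the sine this becomes a polynomial inequality. The
  cubic vanishes at 0 and doubly at 1.\<close>

lemma E_real_le_cubic:
  assumes "0 < x" "x \<le> 1"
  shows "E_real x \<le> 11/5 * (x * (1 - x)\<^sup>2)"
proof -
  define q where "q = x * (1 - x)"
  define g where "g = 1 + 6/5 * q"
  have q: "0 \<le> q" using assms by (simp add: q_def)
  have "sin2 x \<le> (q * g)\<^sup>2"
  proof -
    have "0 \<le> sin (pi * x) / pi" using assms by (intro divide_nonneg_pos sin_ge_zero) auto
    then show ?thesis unfolding sin2_def
      using sin_pi_div_pi_le[of x] assms by (intro power_mono) (auto simp: q_def g_def)
  qed
  have E: "1 / x\<^sup>2 - W_sum x \<le> (3 * x\<^sup>2 + 9 * x + 8) / (x * (3 * x + 4) * (x + 1)\<^sup>2)"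
  proof -
    have "1 / x\<^sup>2 - W_sum x \<le> 1 / x\<^sup>2 - 1 / (x\<^sup>2 * (x + 1)\<^sup>2) - (1 / (x + 1)\<^sup>2 - 1 / ((x + 1) * (x + 1 + 1/3)))"
      using W_sum_rec[OF assms(1)] W_sum_ge[of "x + 1"] assms by linarith
    also have "\<dots> = (3 * x\<^sup>2 + 9 * x + 8) / (x * (3 * x + 4) * (x + 1)\<^sup>2)"
      using assms by (simp add: divide_simps add_pos_pos) (simp add: algebra_simps power2_eq_square)
    finally show ?thesis .
  qed
  have poly: "g\<^sup>2 * (3 * x\<^sup>2 + 9 * x + 8) \<le> 11/5 * ((3 * x + 4) * (x + 1)\<^sup>2)"
  proof -
    \<comment> \<open>A positivity certificate: every summand is nonnegative on [0, 1], and the sum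
      is the difference in question.\<close>
    have "0 \<le> 5 * (x - 2/5)\<^sup>2 + 2/25 * x\<^sup>2 + 777/25 * x^3 + 216/25 * x^4 + 108/25 * (x^4 * (1 - x)) + 108/25 * (x^4 * (1 - x\<^sup>2))"
      using assms by (intro add_nonneg_nonneg mult_nonneg_nonneg) (auto simp: power_le_one)
    also have "\<dots> = 11/5 * ((3 * x + 4) * (x + 1)\<^sup>2) - g\<^sup>2 * (3 * x\<^sup>2 + 9 * x + 8)"
      unfolding g_def q_def by (simp add: field_simps eval_nat_numeral)
    finally show ?thesis by simp
  qed
  have "E_real x = sin2 x * (1 / x\<^sup>2 - W_sum x)" using assms by (simp add: E_real_pos)
  also have "\<dots> \<le> sin2 x * ((3 * x\<^sup>2 + 9 * x + 8) / (x * (3 * x + 4) * (x + 1)\<^sup>2))"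
    by (intro mult_left_mono E) auto
  also have "\<dots> \<le> (q * g)\<^sup>2 * ((3 * x\<^sup>2 + 9 * x + 8) / (x * (3 * x + 4) * (x + 1)\<^sup>2))"
    using assms by (intro mult_right_mono \<open>sin2 x \<le> (q * g)\<^sup>2\<close>) auto
  also have "\<dots> = x * (1 - x)\<^sup>2 * (g\<^sup>2 * (3 * x\<^sup>2 + 9 * x + 8)) / ((3 * x + 4) * (x + 1)\<^sup>2)"
    using assms by (simp add: q_def power_mult_distrib power2_eq_square)
  also have "\<dots> \<le> x * (1 - x)\<^sup>2 * (11/5 * ((3 * x + 4) * (x + 1)\<^sup>2)) / ((3 * x + 4) * (x + 1)\<^sup>2)"
    using assms poly by (intro divide_right_mono mult_left_mono) auto
  also have "\<dots> = 11/5 * (x * (1 - x)\<^sup>2)" using assms by (simp add: add_pos_pos)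
  finally show ?thesis .
qed

subsection \<open>The convolution inequality\<close>

lemma integrable_indicator_mult:
  fixes f :: "real \<Rightarrow> real"
  assumes "integrable lborel f" "A \<in> sets borel"
  shows "integrable lborel (\<lambda>x. indicator A x * f x)"
  using integrable_real_mult_indicator[OF _ assms(1), of A] assms(2) by (simp add: mult.commute)

lemma has_bochner_integral_Ioi_power:
  assumes "0 < a" "0 < n"
  shows "has_bochner_integral lborel (\<lambda>y. indicator {a<..} y * (real n / y ^ Suc n)) (1 / a ^ n)"
proof -
  define F where "F = (\<lambda>y::real. - (1 / y ^ n))"
  have der: "(F has_real_derivative real n / y ^ Suc n) (at y)" if "a < y" for y
  proof -
    have "(F has_real_derivative (real n * y ^ (n - 1)) / (y ^ n * y ^ n)) (at y)"
      unfolding F_def using that assms by (auto intro!: derivative_eq_intros)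
    also have "(real n * y ^ (n - 1)) / (y ^ n * y ^ n) = real n / y ^ Suc n"
      using that assms by (cases n) auto
    finally show ?thesis .
  qed
  have cont: "isCont (\<lambda>y. real n / y ^ Suc n) y" if "a < y" for y
    using that assms by (intro continuous_intros) auto
  have A: "((F \<circ> real_of_ereal) \<longlongrightarrow> F a) (at_right (ereal a))"
  proof -
    have "isCont F a" unfolding F_def using assms by (intro continuous_intros) auto
    then have "(F \<longlongrightarrow> F a) (at_right a)" by (simp add: isCont_def filterlim_at_split)
    then show ?thesis by (simp add: ereal_tendsto_simps)
  qed
  have "((\<lambda>y. 1 / y ^ n) \<longlongrightarrow> (0::real)) at_top"
    using assms by (intro tendsto_divide_0[OF tendsto_const] filterlim_at_top_imp_at_infinity filterlim_pow_at_top filterlim_ident)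
  then have "(F \<longlongrightarrow> 0) at_top" unfolding F_def by (rule tendsto_minus[of _ 0, simplified])
  then have B: "((F \<circ> real_of_ereal) \<longlongrightarrow> 0) (at_left \<infinity>)" by (simp add: ereal_tendsto_simps)
  have nn: "AE y in lborel. ereal a < ereal y \<longrightarrow> ereal y < \<infinity> \<longrightarrow> 0 \<le> real n / y ^ Suc n"
    using assms by (intro AE_I2) auto
  have 1: "set_integrable lborel (einterval (ereal a) \<infinity>) (\<lambda>y. real n / y ^ Suc n)"
    by (rule interval_integral_FTC_nonneg(1)[where F = F, OF _ _ _ nn A B]) (use der cont in auto)
  have 2: "(LBINT y=ereal a..\<infinity>. real n / y ^ Suc n) = 0 - F a"
    by (rule interval_integral_FTC_nonneg(2)[where F = F, OF _ _ _ nn A B]) (use der cont in auto)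
  show ?thesis
    using 1 2 by (simp add: interval_integral_Ioi has_bochner_integral_iff set_integrable_def set_lebesgue_integral_def F_def)
qed

lemma E_real_integrable [simp]: "integrable lborel E_real"
  by (rule integrable_K_bound[where c = 2]) (use E_real_nonneg E_real_le_K in auto)

lemma E_real_sq_integrable [simp]: "integrable lborel (\<lambda>x. (E_real x)\<^sup>2)"
proof (rule integrable_K_bound[where c = 4])
  fix x
  have "E_real x * E_real x \<le> 2 * (2 * K_real x)"
    using E_real_nonneg E_real_le_K E_real_le_2 by (intro mult_mono) auto
  then show "\<bar>(E_real x)\<^sup>2\<bar> \<le> 4 * K_real x" by (simp add: power2_eq_square)
qed measurable

definition E_tail :: "real \<Rightarrow> real" where
  "E_tail a = (\<integral>x. indicator {a<..} x * E_real x \<partial>lborel)"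

text \<open>The oscillation is averaged out by a shift by half a period: \<open>sin2 y + sin2 (y + 1/2) = 1/\<pi>\<^sup>2\<close>.\<close>

lemma E_tail_ge:
  assumes a: "0 \<le> a"
  shows "1 / (2 * pi\<^sup>2 * (a + 3/4)) \<le> E_tail a"
proof -
  define g where "g = (\<lambda>y. sin2 y / (y + 1/4)\<^sup>2)"
  have [measurable]: "g \<in> borel_measurable borel" unfolding g_def by measurable
  have gE: "0 \<le> g y" "g y \<le> E_real y" if "0 < y" for y
    using E_real_ge[OF that] by (simp_all add: g_def)
  have ig: "integrable lborel (\<lambda>y. indicator {c<..} y * g y)" if "0 \<le> c" for c
    by (rule Bochner_Integration.integrable_bound[OF E_real_integrable])
      (use gE that in \<open>auto split: split_indicator simp: E_real_nonneg\<close>)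
  have shift: "indicator {a<..} y * g (y + 1/2) = indicator {a + 1/2<..} (y + 1/2) * g (y + 1/2)" for y
    by (auto split: split_indicator)
  have igs: "integrable lborel (\<lambda>y. indicator {a<..} y * g (y + 1/2))"
    unfolding shift using a by (intro lborel_integrable_shift ig) auto
  have b0: "has_bochner_integral lborel (\<lambda>y. 1 / pi\<^sup>2 * (indicator {a + 3/4<..} (y + 3/4) * (real 1 / (y + 3/4) ^ Suc 1)))
      (1 / pi\<^sup>2 * (1 / (a + 3/4) ^ 1))"
    using a by (intro has_bochner_integral_mult_right lborel_has_bochner_integral_shift[OF has_bochner_integral_Ioi_power]) auto
  have "1 / pi\<^sup>2 * (1 / (a + 3/4)) = (\<integral>y. 1 / pi\<^sup>2 * (indicator {a + 3/4<..} (y + 3/4) * (real 1 / (y + 3/4) ^ Suc 1)) \<partial>lborel)"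
    using has_bochner_integral_integral_eq[OF b0] by simp
  also have "\<dots> \<le> (\<integral>y. indicator {a<..} y * g y + indicator {a<..} y * g (y + 1/2) \<partial>lborel)"
  proof (rule integral_mono)
    fix y :: real
    show "1 / pi\<^sup>2 * (indicator {a + 3/4<..} (y + 3/4) * (real 1 / (y + 3/4) ^ Suc 1))
      \<le> indicator {a<..} y * g y + indicator {a<..} y * g (y + 1/2)"
    proof (cases "a < y")
      case True
      then have y: "0 < y" using a by simp
      have half: "sin2 y + sin2 (y + 1/2) = 1 / pi\<^sup>2"
      proof -
        have "sin (pi * (y + 1/2)) = cos (pi * y)" by (simp add: distrib_left sin_add)
        then show ?thesis by (simp add: sin2_def power_divide add_divide_distrib[symmetric])
      qed
      \<comment> \<open>The unshifted term is weakened to the denominator of the shifted one, so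
        that the two numerators add up to a constant.\<close>
      have "sin2 y / (y + 3/4)\<^sup>2 \<le> g y" unfolding g_def using y by (intro divide_left_mono power_mono) auto
      moreover have "sin2 (y + 1/2) / (y + 3/4)\<^sup>2 = g (y + 1/2)" by (simp add: g_def add.assoc)
      ultimately have "(1 / pi\<^sup>2) / (y + 3/4)\<^sup>2 \<le> g y + g (y + 1/2)"
        unfolding half[symmetric] add_divide_distrib by simp
      with True show ?thesis by (simp add: power2_eq_square)
    qed simp
  qed (use b0 ig[OF a] igs in \<open>auto simp: has_bochner_integral_iff\<close>)
  also have "\<dots> = (\<integral>y. indicator {a<..} y * g y \<partial>lborel) + (\<integral>y. indicator {a<..} y * g (y + 1/2) \<partial>lborel)"
    by (intro Bochner_Integration.integral_add ig[OF a] igs)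
  \<comment> \<open>The shifted half is the tail from a + 1/2, hence at most the tail from a;
    counting that tail twice gives the factor 2 in the bound.\<close>
  also have "(\<integral>y. indicator {a<..} y * g (y + 1/2) \<partial>lborel) = (\<integral>y. indicator {a + 1/2<..} y * g y \<partial>lborel)"
    unfolding shift by (rule lborel_integral_shift)
  also have "\<dots> \<le> E_tail a"
    unfolding E_tail_def
    by (intro integral_mono ig integrable_indicator_mult) (use gE a in \<open>auto split: split_indicator simp: E_real_nonneg\<close>)
  also have "(\<integral>y. indicator {a<..} y * g y \<partial>lborel) \<le> E_tail a"
    unfolding E_tail_def
    by (intro integral_mono ig integrable_indicator_mult) (use gE a in \<open>auto split: split_indicator\<close>)
  finally have "1 / pi\<^sup>2 * (1 / (a + 3/4)) \<le> E_tail a + E_tail a" by simp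
  moreover define r where "r = 1 / pi\<^sup>2 * (1 / (a + 3/4))"
  moreover have "1 / (2 * pi\<^sup>2 * (a + 3/4)) = r / 2" by (simp add: r_def)
  ultimately show ?thesis by linarith
qed

lemma E_real_le_inverse_sq: "0 < x \<Longrightarrow> E_real x \<le> 1 / pi\<^sup>2 * (1 / x\<^sup>2)"
proof -
  assume x: "0 < x"
  have "E_real x \<le> sin2 x / (x * (x + 1/3))" by (rule E_real_le[OF x])
  also have "\<dots> \<le> (1 / pi\<^sup>2) / (x * x)" using x by (intro frac_le sin2_le) auto
  finally show ?thesis by (simp add: power2_eq_square)
qed

lemma has_bochner_integral_unit_polynomial:
  fixes f F :: "real \<Rightarrow> real"
  assumes "\<And>x. (F has_real_derivative f x) (at x)" "continuous_on UNIV f"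
  shows "has_bochner_integral lborel (\<lambda>x. indicator {0..1} x * f x) (F 1 - F 0)"
  using has_bochner_integral_FTC_Icc_real[of 0 1 F f] assms
  by (simp add: mult.commute continuous_on_eq_continuous_at)

text \<open>Both integrals are split at 1: the cubic bound is integrated on [0, 1], and E \<le>
  1/(pi x)^2 on the rest.\<close>

lemma E_pos_integrals:
  shows E_tail_0_le: "E_tail 0 \<le> 11/60 + 1 / pi\<^sup>2"
    and E_sq_pos_le: "(\<integral>x. indicator {0<..} x * (E_real x)\<^sup>2 \<partial>lborel) \<le> 121/2625 + 1 / (3 * pi^4)"
proof -
  have c1: "has_bochner_integral lborel (\<lambda>x::real. indicator {0..1} x * (11/5 * (x * (1 - x)\<^sup>2))) (11/60)"
  proof -
    define F where "F = (\<lambda>x::real. 11/5 * (x^2/2 - 2 * x^3/3 + x^4/4))"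
    have "(F has_real_derivative 11/5 * (x * (1 - x)\<^sup>2)) (at x)" for x :: real
      unfolding F_def by (auto intro!: derivative_eq_intros simp: algebra_simps power2_eq_square power3_eq_cube)
    then have "has_bochner_integral lborel (\<lambda>x::real. indicator {0..1} x * (11/5 * (x * (1 - x)\<^sup>2))) (F 1 - F 0)"
      by (rule has_bochner_integral_unit_polynomial) (intro continuous_intros)
    moreover have "F 1 - F 0 = 11/60" by (simp add: F_def)
    ultimately show ?thesis by (simp only:)
  qed
  have c2: "has_bochner_integral lborel (\<lambda>x::real. indicator {0..1} x * (121/25 * (x\<^sup>2 * (1 - x)^4))) (121/2625)"
  proof -
    define F where "F = (\<lambda>x::real. 121/25 * (x^3/3 - x^4 + 6 * x^5/5 - 2 * x^6/3 + x^7/7))"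
    have "(F has_real_derivative 121/25 * (x\<^sup>2 * (1 - x)^4)) (at x)" for x :: real
      unfolding F_def by (auto intro!: derivative_eq_intros simp: algebra_simps eval_nat_numeral)
    then have "has_bochner_integral lborel (\<lambda>x::real. indicator {0..1} x * (121/25 * (x\<^sup>2 * (1 - x)^4))) (F 1 - F 0)"
      by (rule has_bochner_integral_unit_polynomial) (intro continuous_intros)
    moreover have "F 1 - F 0 = 121/2625" by (simp add: F_def)
    ultimately show ?thesis by (simp only:)
  qed
  have t1: "has_bochner_integral lborel (\<lambda>x. 1 / pi\<^sup>2 * (indicator {1<..} x * (real 1 / x ^ Suc 1))) (1 / pi\<^sup>2 * (1 / 1 ^ 1))"
    by (intro has_bochner_integral_mult_right has_bochner_integral_Ioi_power) auto
  have t3: "has_bochner_integral lborel (\<lambda>x. 1 / (3 * pi^4) * (indicator {1<..} x * (real 3 / x ^ Suc 3))) (1 / (3 * pi^4) * (1 / 1 ^ 3))"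
    by (intro has_bochner_integral_mult_right has_bochner_integral_Ioi_power) auto
  have "E_tail 0 \<le> (\<integral>x. indicator {0..1} x * (11/5 * (x * (1 - x)\<^sup>2)) + 1 / pi\<^sup>2 * (indicator {1<..} x * (real 1 / x ^ Suc 1)) \<partial>lborel)"
    unfolding E_tail_def
  proof (rule integral_mono[OF _ integrable.intros[OF has_bochner_integral_add[OF c1 t1]]])
    fix x :: real
    show "indicator {0<..} x * E_real x \<le> indicator {0..1} x * (11/5 * (x * (1 - x)\<^sup>2)) + 1 / pi\<^sup>2 * (indicator {1<..} x * (real 1 / x ^ Suc 1))"
      using E_real_le_cubic[of x] E_real_le_inverse_sq[of x] by (auto simp: power2_eq_square split: split_indicator)
  qed (auto intro!: integrable_indicator_mult)
  also have "\<dots> = 11/60 + 1 / pi\<^sup>2 * (1 / 1 ^ 1)"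
    by (rule has_bochner_integral_integral_eq[OF has_bochner_integral_add[OF c1 t1]])
  finally show "E_tail 0 \<le> 11/60 + 1 / pi\<^sup>2" by simp
  have "(\<integral>x. indicator {0<..} x * (E_real x)\<^sup>2 \<partial>lborel)
    \<le> (\<integral>x. indicator {0..1} x * (121/25 * (x\<^sup>2 * (1 - x)^4)) + 1 / (3 * pi^4) * (indicator {1<..} x * (real 3 / x ^ Suc 3)) \<partial>lborel)"
  proof (rule integral_mono[OF _ integrable.intros[OF has_bochner_integral_add[OF c2 t3]]])
    fix x :: real
    consider "x \<le> 0" | "0 < x" "x \<le> 1" | "1 < x" by linarith
    then show "indicator {0<..} x * (E_real x)\<^sup>2 \<le> indicator {0..1} x * (121/25 * (x\<^sup>2 * (1 - x)^4)) + 1 / (3 * pi^4) * (indicator {1<..} x * (real 3 / x ^ Suc 3))"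
    proof cases
      case 1
      then show ?thesis by (auto split: split_indicator)
    next
      case 2
      have "(E_real x)\<^sup>2 \<le> (11/5 * (x * (1 - x)\<^sup>2))\<^sup>2"
        using E_real_le_cubic[OF 2] E_real_nonneg by (intro power_mono)
      also have "\<dots> = 121/25 * (x\<^sup>2 * (1 - x)^4)"
        by (simp add: power_mult_distrib power2_eq_square power4_eq_xxxx)
      finally show ?thesis using 2 by simp
    next
      case 3
      have "(E_real x)\<^sup>2 \<le> (1 / pi\<^sup>2 * (1 / x\<^sup>2))\<^sup>2"
        using E_real_le_inverse_sq[of x] E_real_nonneg 3 by (intro power_mono) auto
      also have "\<dots> = 1 / pi^4 * (1 / x^4)"
        by (simp add: power2_eq_square power4_eq_xxxx)
      finally show ?thesis using 3 by (simp add: eval_nat_numeral)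
    qed
  qed (auto intro!: integrable_indicator_mult)
  also have "\<dots> = 121/2625 + 1 / (3 * pi^4) * (1 / 1 ^ 3)"
    by (rule has_bochner_integral_integral_eq[OF has_bochner_integral_add[OF c2 t3]])
  finally show "(\<integral>x. indicator {0<..} x * (E_real x)\<^sup>2 \<partial>lborel) \<le> 121/2625 + 1 / (3 * pi^4)" by simp
qed

definition E_pos :: "real \<Rightarrow> real" where "E_pos x = indicator {0<..} x * E_real x"

lemma E_pos_borel [measurable]: "E_pos \<in> borel_measurable borel"
  unfolding E_pos_def by measurable

lemma E_pos_nonneg: "0 \<le> E_pos x"
  by (simp add: E_pos_def E_real_nonneg)

lemma E_pos_integrable: "integrable lborel E_pos"
  unfolding E_pos_def by (intro integrable_indicator_mult) auto

lemma integral_E_pos: "(\<integral>x. E_pos x \<partial>lborel) = E_tail 0"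
  by (simp add: E_pos_def E_tail_def)

text \<open>For \<open>L \<le> 2\<close> use \<open>2ab \<le> a\<^sup>2 + b\<^sup>2\<close>; for \<open>L > 2\<close> one of \<open>u\<close>, \<open>L - u\<close> is at least
  \<open>L/2\<close>, where \<open>E\<close> is small.\<close>

lemma E_pos_conv_le:
  assumes L: "0 \<le> L"
  shows "(\<integral>u. E_pos u * E_pos (L - u) \<partial>lborel) \<le> 26/7 * E_tail (L + 1)"
proof -
  \<comment> \<open>The tail is replaced by its lower bound, so the convolution need only be
    compared with an explicit function of \<open>L\<close>.\<close>
  have "26/7 * (1 / (2 * pi\<^sup>2 * (L + 7/4))) \<le> 26/7 * E_tail (L + 1)"
  proof -
    have "L + 1 + 3/4 = L + 7/4" by simp
    moreover have "1 / (2 * pi\<^sup>2 * (L + 1 + 3/4)) \<le> E_tail (L + 1)" using L by (intro E_tail_ge) auto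
    ultimately have "1 / (2 * pi\<^sup>2 * (L + 7/4)) \<le> E_tail (L + 1)" by (simp only:)
    then show ?thesis by (intro mult_left_mono) auto
  qed
  moreover have "(\<integral>u. E_pos u * E_pos (L - u) \<partial>lborel) \<le> 26/7 * (1 / (2 * pi\<^sup>2 * (L + 7/4)))"
  proof (cases "L \<le> 2")
    case True
    have isq: "integrable lborel (\<lambda>u. (E_pos u)\<^sup>2)"
      by (rule Bochner_Integration.integrable_bound[OF E_real_sq_integrable])
        (auto simp: E_pos_def split: split_indicator)
    have "(\<integral>u. E_pos u * E_pos (L - u) \<partial>lborel) \<le> (\<integral>u. ((E_pos u)\<^sup>2 + (E_pos (L - u))\<^sup>2) / 2 \<partial>lborel)"
    proof (rule integral_mono')
      show "integrable lborel (\<lambda>u. ((E_pos u)\<^sup>2 + (E_pos (L - u))\<^sup>2) / 2)"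
        using isq lborel_integrable_reflect[OF isq, of L] by auto
      show "E_pos u * E_pos (L - u) \<le> ((E_pos u)\<^sup>2 + (E_pos (L - u))\<^sup>2) / 2" for u
        using sum_squares_bound[of "E_pos u" "E_pos (L - u)"] by simp
    qed (auto simp: E_pos_nonneg)
    also have "\<dots> = ((\<integral>u. (E_pos u)\<^sup>2 \<partial>lborel) + (\<integral>u. (E_pos (L - u))\<^sup>2 \<partial>lborel)) / 2"
      using isq lborel_integrable_reflect[OF isq, of L] by simp
    also have "(\<integral>u. (E_pos (L - u))\<^sup>2 \<partial>lborel) = (\<integral>u. (E_pos u)\<^sup>2 \<partial>lborel)"
      by (rule lborel_integral_reflect)
    also have "(\<integral>u. (E_pos u)\<^sup>2 \<partial>lborel) = (\<integral>x. indicator {0<..} x * (E_real x)\<^sup>2 \<partial>lborel)"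
      by (intro Bochner_Integration.integral_cong) (auto simp: E_pos_def split: split_indicator)
    also have "(\<dots> + \<dots>) / 2 \<le> 121/2625 + 1 / (3 * pi^4)" using E_sq_pos_le by simp
    \<comment> \<open>2/15 is 1/(2 (2 + 7/4)): the target decreases in \<open>L\<close>, so on this
      range it is smallest at L = 2.\<close>
    also have "\<dots> \<le> (26/7 * (2/15)) / pi\<^sup>2"
    proof -
      have "pi\<^sup>2 * (121/2625 + 1 / (3 * pi^4)) = 121/2625 * pi\<^sup>2 + 1 / (3 * pi\<^sup>2)"
        by (simp add: distrib_left eval_nat_numeral)
      also have "1 / (3 * pi\<^sup>2) \<le> 1 / 29" using pi_sq_bounds by (intro divide_left_mono) auto
      also have "121/2625 * pi\<^sup>2 + 1/29 \<le> 26/7 * (2/15)" using pi_sq_bounds by simp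
      finally show ?thesis by (simp add: pos_le_divide_eq mult.commute)
    qed
    also have "\<dots> = 26/7 * (1 / (2 * pi\<^sup>2 * (2 + 7/4)))" by simp
    also have "\<dots> \<le> 26/7 * (1 / (2 * pi\<^sup>2 * (L + 7/4)))"
      using True L by (intro mult_left_mono divide_left_mono) auto
    finally show ?thesis .
  next
    case False
    define \<sigma> where "\<sigma> = 1 / pi\<^sup>2 * (1 / ((L/2) * (L/2 + 1/3)))"
    have \<sigma>: "E_pos y \<le> \<sigma>" if "L/2 \<le> y" for y
    proof -
      have y: "0 < y" using that False by linarith
      have "E_real y \<le> sin2 y / (y * (y + 1/3))" by (rule E_real_le[OF y])
      also have "\<dots> \<le> (1 / pi\<^sup>2) / ((L/2) * (L/2 + 1/3))"
        using that y False by (intro frac_le sin2_le mult_mono) auto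
      finally show ?thesis using y by (simp add: E_pos_def \<sigma>_def)
    qed
    have \<sigma>0: "0 \<le> \<sigma>" using False by (simp add: \<sigma>_def)
    have "(\<integral>u. E_pos u * E_pos (L - u) \<partial>lborel) \<le> (\<integral>u. \<sigma> * (E_pos u + E_pos (L - u)) \<partial>lborel)"
    proof (rule integral_mono')
      show "integrable lborel (\<lambda>u. \<sigma> * (E_pos u + E_pos (L - u)))"
        using E_pos_integrable lborel_integrable_reflect[OF E_pos_integrable, of L] by auto
      fix u
      have "E_pos u * E_pos (L - u) \<le> \<sigma> * E_pos (L - u) \<or> E_pos u * E_pos (L - u) \<le> \<sigma> * E_pos u"
      proof (cases "L/2 \<le> u")
        case True
        then show ?thesis using \<sigma>[of u] E_pos_nonneg by (intro disjI1 mult_right_mono)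
      next
        case False
        then have "E_pos u * E_pos (L - u) \<le> E_pos u * \<sigma>"
          using \<sigma>[of "L - u"] E_pos_nonneg by (intro mult_left_mono) auto
        then show ?thesis by (simp add: mult.commute)
      qed
      moreover have "0 \<le> \<sigma> * E_pos u" "0 \<le> \<sigma> * E_pos (L - u)" using \<sigma>0 E_pos_nonneg by auto
      ultimately show "E_pos u * E_pos (L - u) \<le> \<sigma> * (E_pos u + E_pos (L - u))"
        unfolding distrib_left by linarith
    qed (use \<sigma>0 in \<open>auto simp: E_pos_nonneg\<close>)
    also have "\<dots> = \<sigma> * ((\<integral>u. E_pos u \<partial>lborel) + (\<integral>u. E_pos (L - u) \<partial>lborel))"
      using E_pos_integrable lborel_integrable_reflect[OF E_pos_integrable, of L] by simp
    also have "(\<integral>u. E_pos (L - u) \<partial>lborel) = (\<integral>u. E_pos u \<partial>lborel)" by (rule lborel_integral_reflect)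
    also have "\<sigma> * ((\<integral>u. E_pos u \<partial>lborel) + (\<integral>u. E_pos u \<partial>lborel)) = \<sigma> * (2 * E_tail 0)"
      by (simp add: integral_E_pos)
    also have "\<dots> \<le> \<sigma> * (57/100)"
    proof -
      have "1 / pi\<^sup>2 \<le> 203/2000" using pi_sq_bounds by (simp add: divide_le_eq)
      then have "2 * E_tail 0 \<le> 57/100" using E_tail_0_le by simp
      then show ?thesis using \<sigma>0 by (intro mult_left_mono)
    qed
    also have "\<dots> \<le> 26/7 * (1 / (2 * pi\<^sup>2 * (L + 7/4)))"
    proof -
      \<comment> \<open>Expansion about L = 2, where the case begins; all coefficients are
        nonnegative.\<close>
      have "0 \<le> (L - 2) * (13/7 * L) + (13/7 * (8/3) - 57/25) * (L - 2) + (13/7 * (16/3) - 57/25 * (15/4))"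
        using False by (intro add_nonneg_nonneg mult_nonneg_nonneg) auto
      also have "\<dots> = 13/7 * (L * (L + 2/3)) - 57/25 * (L + 7/4)" by (simp add: field_simps)
      finally have "57/25 * (L + 7/4) \<le> 13/7 * (L * (L + 2/3))" by simp
      then have "57/25 / (L * (L + 2/3)) \<le> 13/7 / (L + 7/4)"
        using False by (simp add: divide_le_eq le_divide_eq)
      then have "1 / pi\<^sup>2 * (57/25 / (L * (L + 2/3))) \<le> 1 / pi\<^sup>2 * (13/7 / (L + 7/4))"
        by (intro mult_left_mono) auto
      moreover have "\<sigma> * (57/100) = 1 / pi\<^sup>2 * (57/25 / (L * (L + 2/3)))"
        using False by (simp add: \<sigma>_def field_simps)
      moreover have "26/7 * (1 / (2 * pi\<^sup>2 * (L + 7/4))) = 1 / pi\<^sup>2 * (13/7 / (L + 7/4))"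
        by simp
      ultimately show ?thesis by (simp only:)
    qed
    finally show ?thesis .
  qed
  ultimately show ?thesis by linarith
qed

lemma E_real_product_integrable:
  "integrable lborel (\<lambda>u. E_real u * E_real (L - u))"
proof (rule Bochner_Integration.integrable_bound)
  show "integrable lborel (\<lambda>u. 2 * E_real u)" by simp
  show "AE u in lborel. norm (E_real u * E_real (L - u)) \<le> norm (2 * E_real u)"
    using mult_left_mono[OF E_real_le_2 E_real_nonneg] E_real_nonneg
    by (intro AE_I2) (simp add: mult.commute)
qed measurable

text \<open>On each of the two mirror-image ranges with a negative argument, E(-v) is at most 2, and
  at most 1/7 = 2 - 13/7 beyond v = 1. Each range thus costs at most
  \<open>2 * E_tail L - 13/7 * E_tail (L + 1)\<close>, and \<open>26/7 * E_tail (L + 1)\<close> of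
  the allowance remains for 0 < u < L.\<close>

lemma E_conv_le:
  assumes L: "0 \<le> L"
  shows "(\<integral>u. E_real u * E_real (L - u) \<partial>lborel) \<le> 4 * E_tail L"
proof -
  define h where "h = (\<lambda>u. indicator {..<0} u * E_real u * E_pos (L - u))"
  have [measurable]: "h \<in> borel_measurable borel" unfolding h_def by measurable
  have E0: "E_real 0 = 0" by (simp add: E_real_def K_real_def H_real_def)
  have ih: "integrable lborel h"
    by (rule Bochner_Integration.integrable_bound[OF E_real_product_integrable[of L]])
      (auto simp: h_def E_pos_def split: split_indicator)
  have ip: "integrable lborel (\<lambda>u. E_pos u * E_pos (L - u))"
    by (rule Bochner_Integration.integrable_bound[OF E_real_product_integrable[of L]])
      (auto simp: E_pos_def split: split_indicator)
  have ihr: "integrable lborel (\<lambda>u. h (L - u))" by (rule lborel_integrable_reflect[OF ih])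
  have "has_bochner_integral lborel (\<lambda>v. indicator {a<..} (v + L) * E_real (v + L)) (E_tail a)" for a
    by (rule lborel_has_bochner_integral_shift)
      (simp add: has_bochner_integral_iff E_tail_def integrable_indicator_mult)
  then have sh: "has_bochner_integral lborel (\<lambda>v. 2 * (indicator {L<..} (v + L) * E_real (v + L))
      - 13/7 * (indicator {L + 1<..} (v + L) * E_real (v + L))) (2 * E_tail L - 13/7 * E_tail (L + 1))"
    by (intro has_bochner_integral_diff has_bochner_integral_mult_right)
  \<comment> \<open>As L \<ge> 0, the arguments u and L - u are never both negative;
    \<open>E_real 0 = 0\<close> covers the boundary points.\<close>
  have "E_real u * E_real (L - u) = E_pos u * E_pos (L - u) + h u + h (L - u)" for u
    using L E0 by (cases u "0::real" rule: linorder_cases; cases "L - u" "0::real" rule: linorder_cases)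
      (auto simp: h_def E_pos_def)
  then have "(\<integral>u. E_real u * E_real (L - u) \<partial>lborel)
      = (\<integral>u. E_pos u * E_pos (L - u) \<partial>lborel) + (\<integral>u. h u \<partial>lborel) + (\<integral>u. h (L - u) \<partial>lborel)"
    using ip ih ihr by simp
  also have "(\<integral>u. h (L - u) \<partial>lborel) = (\<integral>u. h u \<partial>lborel)" by (rule lborel_integral_reflect)
  also have "(\<integral>u. h u \<partial>lborel) = (\<integral>v. h (0 - v) \<partial>lborel)" by (rule lborel_integral_reflect[symmetric])
  also have "\<dots> \<le> (\<integral>v. 2 * (indicator {L<..} (v + L) * E_real (v + L)) - 13/7 * (indicator {L + 1<..} (v + L) * E_real (v + L)) \<partial>lborel)"
  proof (rule integral_mono)
    fix v
    show "h (0 - v) \<le> 2 * (indicator {L<..} (v + L) * E_real (v + L)) - 13/7 * (indicator {L + 1<..} (v + L) * E_real (v + L))"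
    proof (cases "0 < v")
      case True
      have "E_real (- v) \<le> 2 - 13/7 * indicator {1<..} v"
        using E_real_minus_le[OF True] by (auto split: split_indicator)
      then have "E_real (- v) * E_real (v + L) \<le> (2 - 13/7 * indicator {1<..} v) * E_real (v + L)"
        using E_real_nonneg by (intro mult_right_mono)
      then show ?thesis using True L by (auto simp: h_def E_pos_def add.commute algebra_simps split: split_indicator)
    next
      case False
      then show ?thesis by (auto simp: h_def split: split_indicator)
    qed
  qed (use lborel_integrable_reflect[OF ih, of 0] sh in \<open>auto simp: has_bochner_integral_iff\<close>)
  also have "\<dots> = 2 * E_tail L - 13/7 * E_tail (L + 1)"
    by (rule has_bochner_integral_integral_eq[OF sh])
  finally show ?thesis using E_pos_conv_le[OF L] by linarith
qed

subsection \<open>The constant\<close>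

lemma cot_real_deriv:
  assumes "0 < v" "v < 1"
  shows "((\<lambda>v. cot (pi * v)) has_real_derivative - pi * (1 + (cot (pi * v))\<^sup>2)) (at v)"
proof -
  have s: "sin (pi * v) > 0" using assms by (intro sin_gt_zero) auto
  have "((\<lambda>v. cot (pi * v)) has_real_derivative - inverse ((sin (pi * v))\<^sup>2) * pi) (at v)"
    by (rule DERIV_chain2[where f = cot, OF DERIV_cot]) (use s in \<open>auto intro!: derivative_eq_intros\<close>)
  moreover have "inverse ((sin (pi * v))\<^sup>2) = 1 + (cot (pi * v))\<^sup>2"
    using s sin_cos_squared_add[of "pi * v"] by (simp add: cot_def power_divide divide_simps)
  then have "- inverse ((sin (pi * v))\<^sup>2) * pi = - pi * (1 + (cot (pi * v))\<^sup>2)"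
    by (simp add: algebra_simps)
  ultimately show ?thesis by (simp only:)
qed

text \<open>Writing the derivative of the cotangent through 1 + c^2 makes the integrand rational in
  v and a single cotangent value, so the later identities are algebraic.\<close>

definition J_explicit :: "real \<Rightarrow> real" where
  "J_explicit v = (let c = cot (pi * v) in
     (pi * v * (1 - v) * c + v) * (pi * ((1 - 2 * v) * c - pi * v * (1 - v) * (1 + c\<^sup>2)) + 1) / v)"

lemma J_integrand_eq:
  assumes "0 < v" "v < 1"
  shows "J_integrand v = J_explicit v"
proof -
  define c where "c = cot (pi * v)"
  have "((\<lambda>v. pi * v * (1 - v) * cot (pi * v) + v) has_real_derivative
     pi * ((1 - 2 * v) * c - pi * v * (1 - v) * (1 + c\<^sup>2)) + 1) (at v)"
    by (rule derivative_eq_intros cot_real_deriv assms refl)+ (simp add: c_def algebra_simps)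
  then have "(J_hat has_real_derivative
     pi * ((1 - 2 * v) * c - pi * v * (1 - v) * (1 + c\<^sup>2)) + 1) (at v)"
    by (rule has_field_derivative_transform_within_open[where S = "{0<..<1}"])
      (use assms in \<open>auto simp: J_hat_def\<close>)
  then have "deriv J_hat v = pi * ((1 - 2 * v) * c - pi * v * (1 - v) * (1 + c\<^sup>2)) + 1"
    by (rule DERIV_imp_deriv)
  moreover have "J_hat v = pi * v * (1 - v) * c + v" using assms by (simp add: J_hat_def c_def)
  ultimately show ?thesis by (simp add: J_integrand_def J_explicit_def c_def Let_def)
qed

text \<open>With \<open>a(v) = (1 - v) cot(\<pi>v) + 1/\<pi>\<close> we have \<open>J_hat v = \<pi> v a(v)\<close>, hence \<open>2/\<pi>\<^sup>2\<close> times the integrand is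
  \<open>a\<^sup>2 + (v a\<^sup>2)'\<close>, and integrating the \<open>cot\<^sup>2\<close> part of \<open>a\<^sup>2\<close> by parts cancels the \<open>cot\<close> part.\<close>

definition J_antideriv :: "real \<Rightarrow> real" where
  "J_antideriv v = v * ((1 - v) * cot (pi * v) + 1 / pi)\<^sup>2 - (1 - v)\<^sup>2 * cot (pi * v) / pi
     + (1 - v)^3 / 3 + v / pi\<^sup>2"

lemma J_antideriv:
  assumes "0 < v" "v < 1"
  shows "(J_antideriv has_real_derivative 2 / pi\<^sup>2 * J_explicit v) (at v)"
proof -
  define c where "c = cot (pi * v)"
  define c' where "c' = - pi * (1 + c\<^sup>2)"
  have c: "((\<lambda>v. cot (pi * v)) has_real_derivative c') (at v)"
    unfolding c'_def c_def by (rule cot_real_deriv[OF assms])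
  have 1: "((\<lambda>v. v * ((1 - v) * cot (pi * v) + 1 / pi)\<^sup>2) has_real_derivative
      ((1 - v) * c + 1 / pi)\<^sup>2 + v * (2 * ((1 - v) * c + 1 / pi) * ((1 - v) * c' - c))) (at v)"
    by (rule derivative_eq_intros c refl | simp; fail)+ (simp add: c_def algebra_simps)
  have 2: "((\<lambda>v. (1 - v)\<^sup>2 * cot (pi * v) / pi) has_real_derivative ((1 - v)\<^sup>2 * c' - 2 * (1 - v) * c) / pi) (at v)"
    by (rule DERIV_cdivide, (rule derivative_eq_intros c refl | simp; fail)+) (simp add: c_def algebra_simps)
  have 3: "((\<lambda>v. (1 - v)^3 / 3) has_real_derivative - ((1 - v)\<^sup>2)) (at v)"
    by (rule derivative_eq_intros refl | simp; fail)+
  have 4: "((\<lambda>v. v / pi\<^sup>2) has_real_derivative 1 / pi\<^sup>2) (at v)"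
    by (intro DERIV_cdivide DERIV_ident)
  have "(J_antideriv has_real_derivative
      ((1 - v) * c + 1 / pi)\<^sup>2 + v * (2 * ((1 - v) * c + 1 / pi) * ((1 - v) * c' - c))
      - ((1 - v)\<^sup>2 * c' - 2 * (1 - v) * c) / pi + - ((1 - v)\<^sup>2) + 1 / pi\<^sup>2) (at v)"
    unfolding J_antideriv_def by (intro DERIV_add DERIV_diff 1 2 3 4)
  also have "((1 - v) * c + 1 / pi)\<^sup>2 + v * (2 * ((1 - v) * c + 1 / pi) * ((1 - v) * c' - c))
      - ((1 - v)\<^sup>2 * c' - 2 * (1 - v) * c) / pi + - ((1 - v)\<^sup>2) + 1 / pi\<^sup>2 = 2 / pi\<^sup>2 * J_explicit v"
    unfolding J_explicit_def c_def[symmetric] c'_def Let_def using assms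
    by (simp add: divide_simps) (simp add: algebra_simps power2_eq_square)
  finally show ?thesis .
qed

section \<open>Endpoint behaviour of the integrand and its primitive\<close>

lemma filterlim_at_left_1_reflect:
  assumes "filterlim (\<lambda>t::real. f (1 - t)) F (at_right 0)"
  shows "filterlim f F (at_left 1)"
proof -
  have "filterlim (\<lambda>v::real. 1 - v) (at_right 0) (at_left 1)" by real_asymp
  from filterlim_compose[OF assms this] show ?thesis by simp
qed

lemma cot_pi_reflect: "cot (pi * (1 - t)) = - cot (pi * t)"
  by (simp add: cot_def right_diff_distrib)

text \<open>The scaled remainder of pi v cot(pi v) after its limit 1 at 0. It has a finite limit at
  0, so substituting it exhibits the cancellation of poles; the endpoint 1 is reached by
  reflection.\<close>

definition cot_rem :: "real \<Rightarrow> real" where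
  "cot_rem v = (pi * v * cot (pi * v) - 1) / v\<^sup>2"

lemma cot_eq_cot_rem: "v \<noteq> 0 \<Longrightarrow> cot (pi * v) = (1 + cot_rem v * v\<^sup>2) / (pi * v)"
  by (simp add: cot_rem_def)

lemma cot_rem_limit: "(cot_rem \<longlongrightarrow> - pi\<^sup>2 / 3) (at_right 0)"
proof -
  have "((\<lambda>x::real. (x * (cos x / sin x) - 1) / x\<^sup>2) \<longlongrightarrow> - 1 / 3) (at_right 0)" by real_asymp
  moreover have "filterlim (\<lambda>v. pi * v) (at_right 0) (at_right 0)" by real_asymp
  ultimately have "((\<lambda>v. (pi * v * (cos (pi * v) / sin (pi * v)) - 1) / (pi * v)\<^sup>2) \<longlongrightarrow> - 1 / 3) (at_right 0)"
    by (rule filterlim_compose)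
  then have "((\<lambda>v. pi\<^sup>2 * ((pi * v * (cos (pi * v) / sin (pi * v)) - 1) / (pi * v)\<^sup>2)) \<longlongrightarrow> pi\<^sup>2 * (- 1 / 3)) (at_right 0)"
    by (rule tendsto_mult_left)
  moreover have "(\<lambda>v. pi\<^sup>2 * ((pi * v * (cos (pi * v) / sin (pi * v)) - 1) / (pi * v)\<^sup>2)) = cot_rem"
    by (auto simp: fun_eq_iff cot_rem_def cot_def power_mult_distrib)
  ultimately show ?thesis by simp
qed

lemma J_explicit_limits:
  shows "(J_explicit \<longlongrightarrow> - 2 * pi\<^sup>2 / 3) (at_right 0)" "(J_explicit \<longlongrightarrow> 0) (at_left 1)"
proof -
  have id: "((\<lambda>v. v) \<longlongrightarrow> 0) (at_right (0::real))" by (rule tendsto_ident_at)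
  \<comment> \<open>The two factors are \<open>J_hat\<close> and its derivative divided by v, with
    the negative powers of v already cancelled.\<close>
  define f where "f = (\<lambda>v. (1 + cot_rem v * v\<^sup>2 * (1 - v)) *
     ((1 - 2 * v) * cot_rem v - (1 - v) * (2 * cot_rem v + (cot_rem v)\<^sup>2 * v\<^sup>2) - pi\<^sup>2 * (1 - v)))"
  have "(f \<longlongrightarrow> - 2 * pi\<^sup>2 / 3) (at_right 0)"
    unfolding f_def by (rule tendsto_eq_intros cot_rem_limit id refl)+ simp
  moreover have "f v = J_explicit v" if "0 < v" for v
  proof -
    define r where "r = cot_rem v"
    show ?thesis
      unfolding J_explicit_def Let_def f_def using that
      by (simp add: cot_eq_cot_rem flip: r_def; simp add: divide_simps; simp add: algebra_simps power2_eq_square)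
  qed
  then have "\<forall>\<^sub>F v in at_right 0. f v = J_explicit v"
    using eventually_at_right_less[of 0] by (auto elim!: eventually_mono)
  ultimately show "(J_explicit \<longlongrightarrow> - 2 * pi\<^sup>2 / 3) (at_right 0)" by (rule Lim_transform_eventually)
  define g where "g = (\<lambda>t. - cot_rem t * t * ((1 - 2 * t) * (1 + cot_rem t * t\<^sup>2) - pi\<^sup>2 * (1 - t) * t\<^sup>2
     - (1 - t) * (1 + cot_rem t * t\<^sup>2)\<^sup>2 + t))"
  have "(g \<longlongrightarrow> 0) (at_right 0)"
    unfolding g_def by (rule tendsto_eq_intros cot_rem_limit id refl)+ simp
  moreover have "g t = J_explicit (1 - t)" if "0 < t" "t < 1" for t
  proof -
    define r where "r = cot_rem t"
    show ?thesis
      unfolding J_explicit_def Let_def g_def cot_pi_reflect using that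
      by (simp add: cot_eq_cot_rem flip: r_def; simp add: divide_simps; simp add: algebra_simps power2_eq_square)
  qed
  then have "\<forall>\<^sub>F t in at_right 0. g t = J_explicit (1 - t)"
    using eventually_at_right_real[of 0 1] by (auto elim!: eventually_mono)
  ultimately show "(J_explicit \<longlongrightarrow> 0) (at_left 1)"
    by (intro filterlim_at_left_1_reflect) (rule Lim_transform_eventually)
qed

text \<open>At 0 the squared and the linear cotangent term each have a pole 1/(pi^2 v), and these
  cancel. The difference of the two limits is the integral that enters
  \<open>c_const\<close>.\<close>

lemma J_antideriv_limits:
  shows "(J_antideriv \<longlongrightarrow> 1 / 3 + 2 / pi\<^sup>2) (at_right 0)" "(J_antideriv \<longlongrightarrow> 1 / pi\<^sup>2) (at_left 1)"
proof -
  have id: "((\<lambda>v. v) \<longlongrightarrow> 0) (at_right (0::real))" by (rule tendsto_ident_at)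
  define f where "f = (\<lambda>v. (2 * cot_rem v * v * (1 - v) + (cot_rem v)\<^sup>2 * v^3 * (1 - v)\<^sup>2 + (2 - v) - (1 - v)\<^sup>2 * cot_rem v * v) / pi\<^sup>2
      + (1 - v)^3 / 3 + v / pi\<^sup>2)"
  have "(f \<longlongrightarrow> 1 / 3 + 2 / pi\<^sup>2) (at_right 0)"
    unfolding f_def by (rule tendsto_eq_intros cot_rem_limit id refl | simp; fail)+
  moreover have "f v = J_antideriv v" if "0 < v" for v
  proof -
    define r where "r = cot_rem v"
    show ?thesis
      unfolding J_antideriv_def f_def using that
      by (simp add: cot_eq_cot_rem flip: r_def; simp add: divide_simps; simp add: algebra_simps power2_eq_square power3_eq_cube)
  qed
  then have "\<forall>\<^sub>F v in at_right 0. f v = J_antideriv v"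
    using eventually_at_right_less[of 0] by (auto elim!: eventually_mono)
  ultimately show "(J_antideriv \<longlongrightarrow> 1 / 3 + 2 / pi\<^sup>2) (at_right 0)" by (rule Lim_transform_eventually)
  define g where "g = (\<lambda>t. (1 - t) * (cot_rem t * t\<^sup>2)\<^sup>2 / pi\<^sup>2 + t * (1 + cot_rem t * t\<^sup>2) / pi\<^sup>2 + t^3 / 3 + (1 - t) / pi\<^sup>2)"
  have "(g \<longlongrightarrow> 1 / pi\<^sup>2) (at_right 0)"
    unfolding g_def by (rule tendsto_eq_intros cot_rem_limit id refl | simp; fail)+
  moreover have "g t = J_antideriv (1 - t)" if "0 < t" "t < 1" for t
  proof -
    define r where "r = cot_rem t"
    show ?thesis
      unfolding J_antideriv_def g_def cot_pi_reflect using that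
      by (simp add: cot_eq_cot_rem flip: r_def; simp add: divide_simps; simp add: algebra_simps power2_eq_square power3_eq_cube)
  qed
  then have "\<forall>\<^sub>F t in at_right 0. g t = J_antideriv (1 - t)"
    using eventually_at_right_real[of 0 1] by (auto elim!: eventually_mono)
  ultimately show "(J_antideriv \<longlongrightarrow> 1 / pi\<^sup>2) (at_left 1)"
    by (intro filterlim_at_left_1_reflect) (rule Lim_transform_eventually)
qed

lemma J_explicit_isCont:
  assumes "0 < v" "v < 1"
  shows "isCont J_explicit v"
proof -
  have "sin (pi * v) \<noteq> 0" using sin_gt_zero[of "pi * v"] assms by simp
  then show ?thesis
    unfolding J_explicit_def Let_def using assms by (intro continuous_intros) simp_all
qed

text \<open>The endpoint limits extend the integrand to a continuous function on the compact
  interval [0, 1].\<close>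

lemma J_explicit_integrable: "set_integrable lborel {0<..<1} J_explicit"
proof -
  define g where "g v = (if v \<le> 0 then - 2 * pi\<^sup>2 / 3 else if 1 \<le> v then 0 else J_explicit v)" for v
  have "continuous_on {0..1} g"
  proof (rule continuous_on_IccI)
    show "(g \<longlongrightarrow> g 0) (at_right 0)"
    proof (rule Lim_transform_eventually)
      show "(J_explicit \<longlongrightarrow> g 0) (at_right 0)" using J_explicit_limits(1) by (simp add: g_def)
      show "\<forall>\<^sub>F v in at_right 0. J_explicit v = g v"
        using eventually_at_right_less[of 0] eventually_at_right_real[of 0 1] by (auto elim!: eventually_mono simp: g_def)
    qed
    show "(g \<longlongrightarrow> g 1) (at_left 1)"
    proof (rule Lim_transform_eventually)
      show "(J_explicit \<longlongrightarrow> g 1) (at_left 1)" using J_explicit_limits(2) by (simp add: g_def)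
      show "\<forall>\<^sub>F v in at_left 1. J_explicit v = g v"
        using eventually_at_left_real[of 0 1] by (auto elim!: eventually_mono simp: g_def)
    qed
    fix v :: real assume v: "0 < v" "v < 1"
    have "(g \<longlongrightarrow> J_explicit v) (at v)"
    proof (rule Lim_transform_within_open[where s = "{0<..<1}" and f = J_explicit])
      show "(J_explicit \<longlongrightarrow> J_explicit v) (at v)" using J_explicit_isCont[OF v] by (simp add: isCont_def)
    qed (use v in \<open>auto simp: g_def\<close>)
    then show "(g \<longlongrightarrow> g v) (at v)" using v by (simp add: g_def)
  qed simp
  then have "set_integrable lborel {0..1} g" by (rule borel_integrable_atLeastAtMost')
  then have "set_integrable lborel {0<..<1} g" by (rule set_integrable_subset) auto
  then show ?thesis by (rule set_integrable_cong[THEN iffD1, rotated -1]) (auto simp: g_def)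
qed

lemma J_integrand_integrable: "set_integrable lborel {0<..<1} J_integrand"
  using J_explicit_integrable by (rule set_integrable_cong[THEN iffD1, rotated -1]) (auto simp: J_integrand_eq)

lemma c_const_eq: "c_const = 1 - 1 / pi\<^sup>2"
proof -
  have "(LBINT v=0..1. 2 / pi\<^sup>2 * J_explicit v) = 1 / pi\<^sup>2 - (1 / 3 + 2 / pi\<^sup>2)"
  proof (rule interval_integral_FTC_integrable[where F = J_antideriv])
    fix v :: real assume v: "0 < ereal v" "ereal v < 1"
    then have v': "0 < v" "v < 1" by (simp_all add: zero_ereal_def one_ereal_def)
    show "(J_antideriv has_vector_derivative 2 / pi\<^sup>2 * J_explicit v) (at v)"
      using J_antideriv[OF v'] by (simp add: has_real_derivative_iff_has_vector_derivative)
    show "isCont (\<lambda>v. 2 / pi\<^sup>2 * J_explicit v) v"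
      using J_explicit_isCont[OF v'] by (intro continuous_intros) auto
  next
    show "set_integrable lborel (einterval 0 1) (\<lambda>v. 2 / pi\<^sup>2 * J_explicit v)"
      using J_explicit_integrable by (simp add: zero_ereal_def one_ereal_def)
  qed (use J_antideriv_limits in \<open>simp_all add: zero_ereal_def one_ereal_def ereal_tendsto_simps\<close>)
  moreover have "(LBINT v=0..1. 2 / pi\<^sup>2 * J_explicit v) = 2 / pi\<^sup>2 * (LBINT v:{0<..<1}. J_explicit v)"
    by (simp add: interval_lebesgue_integral_def zero_ereal_def one_ereal_def)
  moreover have "(LBINT v:{0<..<1}. J_explicit v) = (LBINT v:{0<..<1}. J_integrand v)"
    by (rule set_lebesgue_integral_cong) (auto simp: J_integrand_eq)
  ultimately show ?thesis by (simp add: c_const_def)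
qed

subsection \<open>The square integral of the majorant\<close>

text \<open>For x > 0, E(x) = K + (H - 1) and E(-x) = K - (H - 1). In the sum of squares the
  products of K and H cancel, and the tail term removes what is linear in H, leaving the even
  function 2K + K^2 - (1 - H^2).\<close>

lemma E_tail_plus_E_sq: "2 * E_tail 0 + (\<integral>x. (E_real x)\<^sup>2 \<partial>lborel) / 2 = 1 - 1 / pi\<^sup>2"
proof -
  define g where "g = (\<lambda>x. 2 * K_real x + (sin2 x)\<^sup>2 / x^4 - (1 - (H_real x)\<^sup>2))"
  have g: "has_bochner_integral lborel g (2 * 1 + 2/3 - (2/3 + 2 / pi\<^sup>2))"
    unfolding g_def
    by (intro has_bochner_integral_diff has_bochner_integral_add has_bochner_integral_mult_right
        K_real_integral has_bochner_integral_K2 integral_one_minus_H_sq)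
  have even: "g (- x) = g x" for x by (simp add: g_def H_real_minus)
  have "(\<integral>x. (E_real x)\<^sup>2 \<partial>lborel) = (\<integral>x. indicator {0<..} x * ((E_real x)\<^sup>2 + (E_real (- x))\<^sup>2) \<partial>lborel)"
    by (rule lborel_integral_fold) simp
  moreover have "integrable lborel (\<lambda>x. indicator {0<..} x * ((E_real x)\<^sup>2 + (E_real (- x))\<^sup>2))"
    using lborel_integrable_reflect[OF E_real_sq_integrable, of 0]
    by (intro integrable_indicator_mult Bochner_Integration.integrable_add) auto
  moreover have "integrable lborel (\<lambda>x. indicator {0<..} x * E_real x)"
    by (intro integrable_indicator_mult) auto
  ultimately have "2 * E_tail 0 + (\<integral>x. (E_real x)\<^sup>2 \<partial>lborel) / 2
    = (\<integral>x. 2 * (indicator {0<..} x * E_real x) + (indicator {0<..} x * ((E_real x)\<^sup>2 + (E_real (- x))\<^sup>2)) / 2 \<partial>lborel)"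
    by (simp add: E_tail_def)
  also have "\<dots> = (\<integral>x. (indicator {0<..} x * (g x + g (- x))) / 2 \<partial>lborel)"
  proof (rule Bochner_Integration.integral_cong)
    fix x :: real
    show "2 * (indicator {0<..} x * E_real x) + (indicator {0<..} x * ((E_real x)\<^sup>2 + (E_real (- x))\<^sup>2)) / 2
      = (indicator {0<..} x * (g x + g (- x))) / 2"
    proof (cases "0 < x")
      case True
      have "(K_real x)\<^sup>2 = (sin2 x)\<^sup>2 / x^4" by (simp add: K_real_def power_divide)
      then have "2 * E_real x + ((E_real x)\<^sup>2 + (E_real (- x))\<^sup>2) / 2 = g x"
        using True by (simp add: E_real_def H_real_minus g_def power2_eq_square field_simps)
      with True show ?thesis by (simp add: even)
    qed simp
  qed simp
  also have "\<dots> = (\<integral>x. g x \<partial>lborel) / 2"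
    using lborel_integral_fold[of g] g by (simp add: has_bochner_integral_iff)
  also have "\<dots> = 1 - 1 / pi\<^sup>2" using g by (simp add: has_bochner_integral_iff)
  finally show ?thesis .
qed

definition B_real :: "real \<Rightarrow> real" where "B_real x = K_real x + H_real x"

lemma B_fun_eq:
  assumes "x \<notin> \<int>"
  shows "B_fun x = B_real x"
proof -
  have "x \<noteq> 0" using assms by auto
  then show ?thesis
    using H_fun_eq[OF assms]
    by (simp add: B_fun_def B_real_def K_fun_def K_real_def sin2_def power_divide power_mult_distrib)
qed

text \<open>The problem rescaled to \<delta> = 1, with N = \<delta>M and \<open>B_real\<close> in
  place of \<open>B_fun\<close>.\<close>

lemma majorant_sq_integral:
  assumes N: "0 \<le> N"
  defines "c \<equiv> \<lambda>x. ((B_real (N - x) + B_real (x + N)) / 2)\<^sup>2"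
  shows "integrable lborel c" "(\<integral>x. c x \<partial>lborel) \<le> 2 * N + (1 - 1 / pi\<^sup>2)"
proof -
  define X where "X = (\<lambda>x. indicator {- N<..<N} x :: real)"
  define e1 where "e1 = (\<lambda>x. E_real (N - x))"
  define e2 where "e2 = (\<lambda>x. E_real (x + N))"
  have X: "has_bochner_integral lborel X (2 * N)"
    using N by (simp add: X_def has_bochner_integral_iff)
  have intE: "has_bochner_integral lborel E_real (\<integral>x. E_real x \<partial>lborel)"
    by (simp add: has_bochner_integral_iff)
  have intE2: "has_bochner_integral lborel (\<lambda>x. (E_real x)\<^sup>2) (\<integral>x. (E_real x)\<^sup>2 \<partial>lborel)"
    by (simp add: has_bochner_integral_iff)
  have part: "has_bochner_integral lborel (\<lambda>u. indicator {0<..<2 * N} u * E_real u) (E_tail 0 - E_tail (2 * N))"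
  proof -
    have int: "has_bochner_integral lborel (\<lambda>u. indicator {0<..} u * E_real u - indicator {2 * N<..} u * E_real u) (E_tail 0 - E_tail (2 * N))"
      by (intro has_bochner_integral_diff) (simp_all add: has_bochner_integral_iff E_tail_def integrable_indicator_mult)
    have "AE u in lborel. indicator {0<..} u * E_real u - indicator {2 * N<..} u * E_real u = indicator {0<..<2 * N} u * E_real u"
      using AE_lborel_singleton[of "2 * N"] by eventually_elim (use N in \<open>auto split: split_indicator\<close>)
    moreover have "(\<lambda>u. indicator {0<..<2 * N} u * E_real u) \<in> borel_measurable lborel" by measurable
    ultimately show ?thesis
      using has_bochner_integral_cong_AE[OF borel_measurable_has_bochner_integral[OF int]] int by blast
  qed
  have Xe1: "has_bochner_integral lborel (\<lambda>x. X x * e1 x) (E_tail 0 - E_tail (2 * N))"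
  proof -
    have "(\<lambda>x. X x * e1 x) = (\<lambda>x. indicator {0<..<2 * N} (N - x) * E_real (N - x))"
      by (auto simp: X_def e1_def split: split_indicator)
    then show ?thesis using lborel_has_bochner_integral_reflect[OF part, of N] by simp
  qed
  have Xe2: "has_bochner_integral lborel (\<lambda>x. X x * e2 x) (E_tail 0 - E_tail (2 * N))"
  proof -
    have "(\<lambda>x. X x * e2 x) = (\<lambda>x. indicator {0<..<2 * N} (x + N) * E_real (x + N))"
      by (auto simp: X_def e2_def split: split_indicator)
    then show ?thesis using lborel_has_bochner_integral_shift[OF part, of N] by simp
  qed
  have e12: "has_bochner_integral lborel (\<lambda>x. (e1 x)\<^sup>2) (\<integral>x. (E_real x)\<^sup>2 \<partial>lborel)"
    unfolding e1_def by (rule lborel_has_bochner_integral_reflect[OF intE2])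
  have e22: "has_bochner_integral lborel (\<lambda>x. (e2 x)\<^sup>2) (\<integral>x. (E_real x)\<^sup>2 \<partial>lborel)"
    unfolding e2_def by (rule lborel_has_bochner_integral_shift[OF intE2])
  define G where "G = (\<integral>u. E_real u * E_real (2 * N - u) \<partial>lborel)"
  have G: "has_bochner_integral lborel (\<lambda>x. e1 x * e2 x) G"
  proof -
    have "has_bochner_integral lborel (\<lambda>u. E_real u * E_real (2 * N - u)) G"
      using E_real_product_integrable by (simp add: has_bochner_integral_iff G_def)
    from lborel_has_bochner_integral_reflect[OF this, of N] show ?thesis
      by (simp add: e1_def e2_def add.commute)
  qed
  \<comment> \<open>Off the endpoints the majorant is \<open>X x + (e1 x + e2 x) / 2\<close>; this
    is its square, expanded with \<open>X x * X x = X x\<close>.\<close>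
  define d where "d = (\<lambda>x. X x + (X x * e1 x + X x * e2 x) + ((e1 x)\<^sup>2 + (e2 x)\<^sup>2) / 4 + (e1 x * e2 x) / 2)"
  have d: "has_bochner_integral lborel d (2 * N + (E_tail 0 - E_tail (2 * N) + (E_tail 0 - E_tail (2 * N)))
     + ((\<integral>x. (E_real x)\<^sup>2 \<partial>lborel) + (\<integral>x. (E_real x)\<^sup>2 \<partial>lborel)) / 4 + G / 2)"
    unfolding d_def by (intro has_bochner_integral_add has_bochner_integral_divide_zero X Xe1 Xe2 e12 e22 G)
  have "AE x in lborel. d x = c x"
    using AE_lborel_singleton[of N] AE_lborel_singleton[of "- N"]
  proof eventually_elim
    fix x assume "x \<noteq> N" "x \<noteq> - N"
    then have "(sgn (N - x) + sgn (x + N)) / 2 = X x"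
      using N by (auto simp: X_def sgn_if split: split_indicator)
    then have "(B_real (N - x) + B_real (x + N)) / 2 = X x + (e1 x + e2 x) / 2"
      by (simp add: B_real_def e1_def e2_def E_real_def field_simps)
    then have "c x = (X x + (e1 x + e2 x) / 2)\<^sup>2" by (simp only: c_def)
    also have "\<dots> = X x * X x + X x * (e1 x + e2 x) + ((e1 x)\<^sup>2 + (e2 x)\<^sup>2) / 4 + (e1 x * e2 x) / 2"
      by (simp add: field_simps power2_eq_square)
    also have "X x * X x = X x" by (simp add: X_def split: split_indicator)
    finally show "d x = c x" by (simp add: d_def distrib_left)
  qed
  moreover have "c \<in> borel_measurable lborel" unfolding c_def B_real_def by measurable
  ultimately have c: "has_bochner_integral lborel c (2 * N + (E_tail 0 - E_tail (2 * N) + (E_tail 0 - E_tail (2 * N)))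
     + ((\<integral>x. (E_real x)\<^sup>2 \<partial>lborel) + (\<integral>x. (E_real x)\<^sup>2 \<partial>lborel)) / 4 + G / 2)"
    using d has_bochner_integral_cong_AE[OF borel_measurable_has_bochner_integral[OF d]] by blast
  then show "integrable lborel c" by (rule integrable.intros)
  \<comment> \<open>Half of \<open>G\<close> is absorbed by the two terms
    \<open>- E_tail (2 * N)\<close>; the rest is 2N plus the constant from
    \<open>E_tail_plus_E_sq\<close>.\<close>
  have "G \<le> 4 * E_tail (2 * N)" unfolding G_def using N by (intro E_conv_le) simp
  then show "(\<integral>x. c x \<partial>lborel) \<le> 2 * N + (1 - 1 / pi\<^sup>2)"
    using has_bochner_integral_integral_eq[OF c] E_tail_plus_E_sq by simp
qed

text \<open>Both integrability claims are included because the integral of a non-integrable function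
  is 0 by convention; with them the inequality and the constant carry their intended
  meaning.\<close>

theorem theorem4p1:
  fixes M \<delta> :: real
  assumes "M \<ge> 0" and "\<delta> > 0"
  shows "integrable lborel (\<lambda>t. \<bar>C_majorant (- M) M \<delta> t\<bar>\<^sup>2) \<and>
         (LBINT t. \<bar>C_majorant (- M) M \<delta> t\<bar>\<^sup>2) \<le> 2 * M + c_const * inverse \<delta> \<and>
         set_integrable lborel {0<..<1} J_integrand \<and>
         0.898678 \<le> c_const \<and> c_const < 0.898679"
proof (intro conjI)
  define N where "N = \<delta> * M"
  have N: "0 \<le> N" using assms by (simp add: N_def)
  define c where "c = (\<lambda>x. ((B_real (N - x) + B_real (x + N)) / 2)\<^sup>2)"
  note c = majorant_sq_integral[OF N, folded c_def]
  \<comment> \<open>The points at which an argument of B is an integer, where \<open>B_fun\<close>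
    and \<open>B_real\<close> are not known to agree; they are countable and so do not affect the
    integral.\<close>
  define Z where "Z = (\<lambda>k::int. M - of_int k / \<delta>) ` UNIV \<union> (\<lambda>k::int. of_int k / \<delta> - M) ` UNIV"
  have Z: "countable Z" by (simp add: Z_def)
  have eq: "c (\<delta> * t) = \<bar>C_majorant (- M) M \<delta> t\<bar>\<^sup>2" if "t \<notin> Z" for t
  proof -
    have "\<delta> * (M - t) \<notin> \<int>"
    proof
      assume "\<delta> * (M - t) \<in> \<int>"
      then obtain k where "\<delta> * (M - t) = of_int k" by (elim Ints_cases)
      then have "t = M - of_int k / \<delta>" using assms by (simp add: field_simps)
      then show False using that by (auto simp: Z_def)
    qed
    moreover have "\<delta> * (t + M) \<notin> \<int>"
    proof
      assume "\<delta> * (t + M) \<in> \<int>"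
      then obtain k where "\<delta> * (t + M) = of_int k" by (elim Ints_cases)
      then have "t = of_int k / \<delta> - M" using assms by (simp add: field_simps)
      then show False using that by (auto simp: Z_def)
    qed
    ultimately show ?thesis
      unfolding power2_abs by (simp add: C_majorant_def B_fun_eq c_def N_def) (simp add: algebra_simps)
  qed
  have scaled: "integrable lborel (\<lambda>t. c (\<delta> * t))"
    using lborel_integrable_real_affine[OF c(1), of \<delta> 0] assms by simp
  then show "integrable lborel (\<lambda>t. \<bar>C_majorant (- M) M \<delta> t\<bar>\<^sup>2)"
    by (rule integrable_discrete_difference[OF Z, THEN iffD1, rotated -1]) (auto simp: eq)
  have "(LBINT t. \<bar>C_majorant (- M) M \<delta> t\<bar>\<^sup>2) = (\<integral>t. c (\<delta> * t) \<partial>lborel)"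
    by (rule integral_discrete_difference[OF Z]) (auto simp: eq)
  also have "\<dots> = (\<integral>t. c t \<partial>lborel) * inverse \<delta>"
    using lborel_integral_real_affine[of \<delta> c 0] assms by simp
  also have "\<dots> \<le> (2 * N + c_const) * inverse \<delta>"
    using c(2) assms by (intro mult_right_mono) (auto simp: c_const_eq)
  also have "\<dots> = 2 * M + c_const * inverse \<delta>" using assms by (simp add: N_def field_simps)
  finally show "(LBINT t. \<bar>C_majorant (- M) M \<delta> t\<bar>\<^sup>2) \<le> 2 * M + c_const * inverse \<delta>" .
  show "set_integrable lborel {0<..<1} J_integrand" by (rule J_integrand_integrable)
  have "1 / pi\<^sup>2 \<le> 0.101322" "0.101321 < 1 / pi\<^sup>2"
    using pi_sq_bounds by (simp_all add: divide_le_eq less_divide_eq)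
  then show "0.898678 \<le> c_const" "c_const < 0.898679" by (simp_all add: c_const_eq)
qed

end
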